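(* Let $m\ge1$, let $f$ be a spherical polynomial of degree $d$ on $\mathbb{R}^{2m}$, let $\vec{\bm c}_0=(\bm c^{(0)}_j)_j,\vec{\bm c}_1=(\bm c^{(1)}_j)_j\in\overline{\mathcal{C}}^m$, let $\vec{\bm a}=(\bm a_1,\dots,\bm a_m)\in\mathbb{R}^{2m}$ with $\bm a_j\in R(\bm c_j^{(0)})\cap R(\bm c_j^{(1)})$ for all $j$, and $\vec{\bm b}\in\mathbb{R}^{2m}$. For each component $\bm c\in\mathcal{S}$ of $\vec{\bm c}_0$ or $\vec{\bm c}_1$ choose any $\bm c'\in\mathcal{C}$ (the choice may depend on the component) and set $\bm c(t)=\bm c+t\bm c'$ for $t\ge0$; for a component $\bm c\in\mathcal{C}$ set $\bm c(t)=\bm c$. Let $\vec{\bm c}_i(t)$ be obtained from $\vec{\bm c}_i$ by replacing each component $\bm c$ by $\bm c(t)$ (so $\vec{\bm c}_i(t)\in\mathcal{C}^m$ for $t>0$). Then \[ \lim_{t\to0^+}\theta^{\vec{\bm c}_0(t),\vec{\bm c}_1(t)}_{\vec{\bm a},\vec{\bm b}}[f](\tau)=\theta^{\vec{\bm c}_0,\vec{\bm c}_1}_{\vec{\bm a},\vec{\bm b}}[f](\tau). \]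
   Context: Write points of $\mathbb{R}^{2m}$ as $\vec{\bm x}=(\bm x_1,\dots,\bm x_m)$ with $\bm x_j=(x_j,y_j)^T$. $Q_m(\vec{\bm x})=\sum_j x_jy_j$, $B_m(\vec{\bm x},\vec{\bm x}')=\sum_j(x_jy_j'+y_jx_j')$; $Q_1,B_1$ are the case $m=1$. $\Delta_m=2\sum_j\partial^2/\partial x_j\partial y_j$; a spherical polynomial of degree $d$ is a homogeneous degree-$d$ polynomial annihilated by $\Delta_m$. $\mathcal{C}=\{\bm c=(c_1,c_2)^T\in\mathbb{R}^2: Q_1(\bm c)<0,\ c_2>0\}$, $\mathcal{S}=\{\bm c=(c_1,c_2)^T\in\mathbb{Z}^2:\gcd(c_1,c_2)=1,\ Q_1(\bm c)=0,\ c_1<c_2\}$, $\overline{\mathcal{C}}=\mathcal{C}\cup\mathcal{S}$. $E(z)=2\int_0^ze^{-\pi u^2}du$, $E^{(k)}$ its $k$-th derivative; $\operatorname{sgn}(x)=1$ for $x>0$, $-1$ for $x\le0$. For $\bm c\in\overline{\mathcal{C}}$, $k\ge0$: $\rho_{\bm c,k}(\bm x)=E^{(k)}(B_1(\bm c,\bm x)/\sqrt{-Q_1(\bm c)})$ if $\bm c\in\mathcal{C}$; $=\operatorname{sgn}(B_1(\bm c,\bm x))$ if $\bm c\in\mathcal{S}$, $k=0$; $=0$ if $\bm c\in\mathcal{S}$, $k>0$. $\partial_{\bm c}(\bm x)=\frac{1}{\sqrt{-Q_1(\bm c)}}(c_1\partial_x+c_2\partial_y)$ (in the coordinates of $\bm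 x=(x,y)^T$) if $\bm c\in\mathcal{C}$, and the identity operator if $\bm c\in\mathcal{S}$. $R(\bm c)=\mathbb{R}^2$ if $\bm c\in\mathcal{C}$ and $R(\bm c)=\{\bm a\in\mathbb{R}^2: B_1(\bm c,\bm a)\notin\mathbb{Z}\}$ if $\bm c\in\mathcal{S}$. $p^{\vec{\bm c}_0,\vec{\bm c}_1}[f](\vec{\bm x})=\sum_{\vec\sigma\in\{0,1\}^m}(-1)^{|\vec\sigma|}\sum_{k=0}^d\frac{(-1)^k}{(4\pi)^k}\sum_{\vec k\in\mathbb{Z}^m_{\ge0},|\vec k|=k}\prod_j\frac{\rho_{\bm c_j^{(\sigma_j)},k_j}(\bm x_j)}{k_j!}\big(\prod_j\partial_{\bm c_j^{(\sigma_j)}}(\bm x_j)^{k_j}\big)f(\vec{\bm x})$. For $\tau=u+iv$, $v>0$, $q=e^{2\pi i\tau}$, $q^\alpha=e^{2\pi i\alpha\tau}$ and admissible data: $\theta^{\vec{\bm c}_0,\vec{\bm c}_1}_{\vec{\bm a},\vec{\bm b}}[f](\tau)=v^{-d/2}\sum_{\vec{\bm x}\in\vec{\bm a}+\mathbb{Z}^{2m}}p^{\vec{\bm c}_0,\vec{\bm c}_1}[f](\vec{\bm x}\sqrt v)\,q^{Q_m(\vec{\bm x})}e^{2\pi iB_m(\vec{\bm x},\vec{\bm b})}$. *)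

theory Defs
  imports "HOL-Analysis.Analysis"
begin

type_synonym 'm space = "(real \<times> real) ^ 'm"

definition Q1 :: "real \<times> real \<Rightarrow> real" where
  "Q1 x = fst x * snd x"

definition B1 :: "real \<times> real \<Rightarrow> real \<times> real \<Rightarrow> real" where
  "B1 x x' = fst x * snd x' + snd x * fst x'"

definition Qm :: "'m::finite space \<Rightarrow> real" where
  "Qm x = (\<Sum>j\<in>UNIV. fst (x $ j) * snd (x $ j))"

definition Bm :: "'m::finite space \<Rightarrow> 'm space \<Rightarrow> real" where
  "Bm x x' = (\<Sum>j\<in>UNIV. fst (x $ j) * snd (x' $ j) + snd (x $ j) * fst (x' $ j))"

definition dX :: "'m::finite \<Rightarrow> ('m space \<Rightarrow> complex) \<Rightarrow> 'm space \<Rightarrow> complex" where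
  "dX j f x = vector_derivative (\<lambda>t. f (x + t *\<^sub>R axis j (1, 0))) (at 0)"

definition dY :: "'m::finite \<Rightarrow> ('m space \<Rightarrow> complex) \<Rightarrow> 'm space \<Rightarrow> complex" where
  "dY j f x = vector_derivative (\<lambda>t. f (x + t *\<^sub>R axis j (0, 1))) (at 0)"

definition Laplace :: "('m::finite space \<Rightarrow> complex) \<Rightarrow> 'm space \<Rightarrow> complex" where
  "Laplace f x = 2 * (\<Sum>j\<in>UNIV. dX j (dY j f) x)"

definition homogeneous_poly :: "nat \<Rightarrow> ('m::finite space \<Rightarrow> complex) \<Rightarrow> bool" where
  "homogeneous_poly d f \<longleftrightarrow>
     (\<exists>coef :: ('m \<Rightarrow> nat) \<times> ('m \<Rightarrow> nat) \<Rightarrow> complex. \<forall>x.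
        f x = (\<Sum>(\<alpha>, \<beta>) \<in> {(\<alpha>, \<beta>). (\<Sum>j\<in>UNIV. \<alpha> j + \<beta> j) = d}.
                 coef (\<alpha>, \<beta>) * of_real (\<Prod>j\<in>UNIV. fst (x $ j) ^ \<alpha> j * snd (x $ j) ^ \<beta> j)))"

definition spherical_poly :: "nat \<Rightarrow> ('m::finite space \<Rightarrow> complex) \<Rightarrow> bool" where
  "spherical_poly d f \<longleftrightarrow> homogeneous_poly d f \<and> (\<forall>x. Laplace f x = 0)"

definition C_cone :: "(real \<times> real) set" where
  "C_cone = {c. Q1 c < 0 \<and> snd c > 0}"

definition S_cusps :: "(real \<times> real) set" where
  "S_cusps = {(of_int c1, of_int c2) | c1 c2 :: int.
                gcd c1 c2 = 1 \<and> Q1 (of_int c1, of_int c2) = 0 \<and> c1 < c2}"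

definition C_bar :: "(real \<times> real) set" where
  "C_bar = C_cone \<union> S_cusps"

text \<open>The interval integral is oriented, so this is also correct for negative \<open>z\<close>.\<close>

definition E_fun :: "real \<Rightarrow> real" where
  "E_fun z = 2 * (LBINT u = ereal 0..ereal z. exp (- pi * u\<^sup>2))"

text \<open>Unlike the library's \<^const>\<open>sgn\<close>, this takes the value \<open>-1\<close> at \<open>0\<close>.\<close>

definition sgn_neg :: "real \<Rightarrow> real" where
  "sgn_neg x = (if x > 0 then 1 else - 1)"

text \<open>In the next three definitions the \<open>else\<close> branches are the case \<open>c \<in> S_cusps\<close>:
  \<^const>\<open>C_cone\<close> and \<^const>\<open>S_cusps\<close> are disjoint, and only
  \<open>c \<in> C_bar\<close> is of interest.\<close>

definition rho :: "real \<times> real \<Rightarrow> nat \<Rightarrow> real \<times> real \<Rightarrow> real" where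
  "rho c k x = (if c \<in> C_cone then (deriv ^^ k) E_fun (B1 c x / sqrt (- Q1 c))
                else if k = 0 then sgn_neg (B1 c x) else 0)"

definition del :: "real \<times> real \<Rightarrow> 'm::finite \<Rightarrow> ('m space \<Rightarrow> complex) \<Rightarrow> 'm space \<Rightarrow> complex" where
  "del c j f = (if c \<in> C_cone
                then (\<lambda>x. (1 / sqrt (- Q1 c)) *\<^sub>R (fst c *\<^sub>R dX j f x + snd c *\<^sub>R dY j f x))
                else f)"

definition R_set :: "real \<times> real \<Rightarrow> (real \<times> real) set" where
  "R_set c = (if c \<in> C_cone then UNIV else {a. B1 c a \<notin> \<int>})"

text \<open>The operator product over \<open>j\<close>, composed in increasing order of the index;
  on polynomials the factors commute.\<close>

definition del_prod ::
  "('m \<Rightarrow> real \<times> real) \<Rightarrow> ('m \<Rightarrow> nat) \<Rightarrow> ('m::{finite,linorder} space \<Rightarrow> complex) \<Rightarrow> 'm space \<Rightarrow> complex"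
where
  "del_prod c \<kappa> f = foldr (\<lambda>j. del (c j) j ^^ \<kappa> j) (sorted_list_of_set UNIV) f"

definition select :: "'m::finite space \<Rightarrow> 'm space \<Rightarrow> ('m \<Rightarrow> nat) \<Rightarrow> 'm \<Rightarrow> real \<times> real" where
  "select c0 c1 \<sigma> j = (if \<sigma> j = 0 then c0 $ j else c1 $ j)"

definition p_fun ::
  "nat \<Rightarrow> 'm::{finite,linorder} space \<Rightarrow> 'm space \<Rightarrow> ('m space \<Rightarrow> complex) \<Rightarrow> 'm space \<Rightarrow> complex"
where
  "p_fun d c0 c1 f x =
     (\<Sum>\<sigma> \<in> {\<sigma> :: 'm \<Rightarrow> nat. \<forall>j. \<sigma> j \<in> {0, 1}}.
        (- 1) ^ (\<Sum>j\<in>UNIV. \<sigma> j) *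
        (\<Sum>k = 0..d. (- 1) ^ k / of_real ((4 * pi) ^ k) *
           (\<Sum>\<kappa> \<in> {\<kappa> :: 'm \<Rightarrow> nat. (\<Sum>j\<in>UNIV. \<kappa> j) = k}.
              of_real (\<Prod>j\<in>UNIV. rho (select c0 c1 \<sigma> j) (\<kappa> j) (x $ j) / fact (\<kappa> j)) *
              del_prod (select c0 c1 \<sigma>) \<kappa> f x)))"

definition shifted_lattice :: "'m::finite space \<Rightarrow> 'm space set" where
  "shifted_lattice a =
     {x. \<forall>j. fst (x $ j) - fst (a $ j) \<in> \<int> \<and> snd (x $ j) - snd (a $ j) \<in> \<int>}"

definition theta ::
  "nat \<Rightarrow> 'm::{finite,linorder} space \<Rightarrow> 'm space \<Rightarrow> 'm space \<Rightarrow> 'm space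
    \<Rightarrow> ('m space \<Rightarrow> complex) \<Rightarrow> complex \<Rightarrow> complex"
where
  "theta d c0 c1 a b f \<tau> =
     of_real (Im \<tau> powr (- real d / 2)) *
     (\<Sum>\<^sub>\<infinity>x\<in>shifted_lattice a.
        p_fun d c0 c1 f (sqrt (Im \<tau>) *\<^sub>R x) *
        exp (2 * of_real pi * \<i> * of_real (Qm x) * \<tau>) *
        exp (2 * of_real pi * \<i> * of_real (Bm x b)))"

definition deform :: "'m::finite space \<Rightarrow> 'm space \<Rightarrow> real \<Rightarrow> 'm space" where
  "deform c c' t = (\<chi> j. if c $ j \<in> S_cusps then c $ j + t *\<^sub>R c' $ j else c $ j)"

lemma finite_multi_indices: "finite {\<kappa> :: 'm::finite \<Rightarrow> nat. (\<Sum>j\<in>UNIV. \<kappa> j) = k}"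
proof (rule finite_subset)
  show "{\<kappa> :: 'm \<Rightarrow> nat. (\<Sum>j\<in>UNIV. \<kappa> j) = k} \<subseteq> PiE UNIV (\<lambda>_. {..k})"
    by (auto simp: PiE_UNIV_domain intro!: member_le_sum)
qed (simp add: finite_PiE)

lemma finite_signs: "finite {\<sigma> :: 'm::finite \<Rightarrow> nat. \<forall>j. \<sigma> j \<in> {0, 1}}"
proof (rule finite_subset)
  show "{\<sigma> :: 'm \<Rightarrow> nat. \<forall>j. \<sigma> j \<in> {0, 1}} \<subseteq> PiE UNIV (\<lambda>_. {0, 1})"
    by (simp add: PiE_UNIV_domain Pi_def)
qed (simp add: finite_PiE)

lemma finite_bi_indices:
  "finite {(\<alpha> :: 'm::finite \<Rightarrow> nat, \<beta> :: 'm \<Rightarrow> nat). (\<Sum>j\<in>UNIV. \<alpha> j + \<beta> j) = d}"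
proof (rule finite_subset)
  have le: "\<alpha> j \<le> d \<and> \<beta> j \<le> d" if "(\<Sum>j\<in>UNIV. \<alpha> j + \<beta> j) = d" for \<alpha> \<beta> :: "'m \<Rightarrow> nat" and j
    using member_le_sum[of j UNIV "\<lambda>j. \<alpha> j + \<beta> j"] that by simp
  show "{(\<alpha> :: 'm \<Rightarrow> nat, \<beta> :: 'm \<Rightarrow> nat). (\<Sum>j\<in>UNIV. \<alpha> j + \<beta> j) = d}
        \<subseteq> PiE UNIV (\<lambda>_. {..d}) \<times> PiE UNIV (\<lambda>_. {..d})"
    using le by (simp add: PiE_UNIV_domain Pi_def subset_iff)
qed (simp add: finite_PiE)

end

theory Submission
  imports Defs "HOL-Probability.Distributions" "HOL-Real_Asymp.Real_Asymp"
begin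

text \<open>
  On a monomial \<open>p_fun\<close> is a product over \<open>j\<close> of differences \<open>P\<^sub>c - P\<^sub>c'\<close> of functions of
  \<open>(x\<^sub>j, y\<^sub>j)\<close>, so by linearity it suffices to treat a single vector \<open>c\<close> in dimension two. There
  \<open>P\<^sub>c\<close> is compared with the reference \<open>sgn (x - y) x\<^sup>\<alpha> y\<^sup>\<beta>\<close>, which cancels in the difference.
  Since \<open>E - sgn\<close> and all derivatives of \<open>E\<close> decay like a Gaussian, \<open>P\<^sub>c - sgn (B(c, x)) x\<^sup>\<alpha> y\<^sup>\<beta>\<close> times
  \<open>exp (- 2 \<pi> x y)\<close> is bounded by a Gaussian in \<open>(s x, y / s)\<close>, where \<open>s = sqrt (- c\<^sub>2 / c\<^sub>1)\<close>; and the two signs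
  differ only where \<open>x y \<ge> 0\<close>, where \<open>exp (- 2 \<pi> x y)\<close> itself decays. As \<open>c\<close> tends to a cusp,
  \<open>s\<close> tends to \<open>\<infinity>\<close> or \<open>0\<close> and the Gaussian degenerates in one direction, but the condition on \<open>a\<close>
  keeps the other coordinate away from \<open>0\<close>, so that \<open>K exp (- \<epsilon> (|x| + |y|))\<close> bounds the terms uniformly
  and dominated convergence over the lattice applies.
\<close>

section \<open>The error function\<close>

lemma E_fun_has_real_derivative:
  "(E_fun has_real_derivative 2 * exp (- pi * z\<^sup>2)) (at z)"
proof -
  \<comment> \<open>The interval \<open>[a, b]\<close> contains 0 and has \<open>z\<close> in its
    interior, so the derivative within it is the two-sided one.\<close>
  define a where "a = - \<bar>z\<bar> - 1"
  define b where "b = \<bar>z\<bar> + 1"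
  have ab: "a < z" "z < b" "a \<le> 0" "0 \<le> b" by (auto simp: a_def b_def)
  have "((\<lambda>u. LBINT y=0..u. exp (- pi * y\<^sup>2)) has_vector_derivative exp (- pi * z\<^sup>2)) (at z within {a..b})"
    unfolding zero_ereal_def using ab by (intro interval_integral_FTC2 continuous_intros) auto
  hence "((\<lambda>u. LBINT y=0..u. exp (- pi * y\<^sup>2)) has_real_derivative exp (- pi * z\<^sup>2)) (at z)"
    using ab by (simp add: has_real_derivative_iff_has_vector_derivative at_within_Icc_at)
  from DERIV_cmult[OF this, of 2] show ?thesis
    unfolding E_fun_def[abs_def] zero_ereal_def by simp
qed

lemma E_fun_0: "E_fun 0 = 0"
  by (simp add: E_fun_def)

lemma E_fun_minus: "E_fun (- z) = - E_fun z"
proof -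
  have "((\<lambda>z. E_fun (- z) + E_fun z) has_real_derivative 0) (at z)" for z
    using DERIV_add[OF DERIV_chain2[OF E_fun_has_real_derivative DERIV_minus[OF DERIV_ident]]
        E_fun_has_real_derivative, of z] by simp
  hence "E_fun (- z) + E_fun z = E_fun (- 0) + E_fun 0"
    using DERIV_isconst_all by blast
  thus ?thesis by (simp add: E_fun_0)
qed

text \<open>The Gaussian integral over the half-line, rescaled by \<open>sqrt pi\<close>, is 1/2,
  and \<open>E_fun y\<close> is twice its truncation at \<open>y\<close>.\<close>

lemma E_fun_at_top: "(E_fun \<longlongrightarrow> 1) at_top"
proof -
  let ?g = "\<lambda>x::real. indicator {0..} x *\<^sub>R exp (- pi * x\<^sup>2)"
  have "has_bochner_integral lborel (\<lambda>x. indicator {0..} (0 + sqrt pi * x) *\<^sub>R exp (- (0 + sqrt pi * x)\<^sup>2))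
      ((sqrt pi / 2) /\<^sub>R \<bar>sqrt pi\<bar>)"
    using gaussian_moment_0 by (subst (asm) lborel_has_bochner_integral_real_affine_iff[of "sqrt pi" _ _ 0]) auto
  also have "(\<lambda>x. indicator {0..} (0 + sqrt pi * x) *\<^sub>R exp (- (0 + sqrt pi * x)\<^sup>2)) = ?g"
    by (simp add: fun_eq_iff indicator_def zero_le_mult_iff power_mult_distrib not_le pi_gt_zero)
  finally have g: "has_bochner_integral lborel ?g (1/2)" by simp
  have "((\<lambda>y. \<integral> x. indicator {..y} x *\<^sub>R ?g x \<partial>lborel) \<longlongrightarrow> \<integral> x. ?g x \<partial>lborel) at_top"
    using g by (intro tendsto_integral_at_top) (auto simp: has_bochner_integral_iff)
  hence "((\<lambda>y. 2 * (\<integral> x. indicator {..y} x *\<^sub>R ?g x \<partial>lborel)) \<longlongrightarrow> 2 * (1/2)) at_top"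
    using g by (intro tendsto_mult tendsto_const) (simp only: has_bochner_integral_iff)
  moreover have "eventually (\<lambda>y. 2 * (\<integral> x. indicator {..y} x *\<^sub>R ?g x \<partial>lborel) = E_fun y) at_top"
    using eventually_ge_at_top[of 0]
  proof eventually_elim
    case (elim y)
    have "E_fun y = 2 * (\<integral> x. indicator {0..y} x *\<^sub>R exp (- pi * x\<^sup>2) \<partial>lborel)"
      using elim by (simp add: E_fun_def interval_integral_Icc set_lebesgue_integral_def)
    also have "(\<lambda>x. indicator {0..y} x *\<^sub>R exp (- pi * x\<^sup>2)) = (\<lambda>x. indicator {..y} x *\<^sub>R ?g x)"
      by (auto simp: fun_eq_iff indicator_def)
    finally show ?case by simp
  qed
  ultimately show ?thesis by (simp add: tendsto_cong)
qed

lemma E_fun_bounds: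
  assumes "z \<ge> 0"
  shows "0 \<le> E_fun z" "E_fun z \<le> 1"
proof -
  have mono: "E_fun x \<le> E_fun y" if "x \<le> y" for x y
  proof (rule DERIV_nonneg_imp_nondecreasing[OF that])
    fix w
    show "\<exists>y. (E_fun has_real_derivative y) (at w) \<and> 0 \<le> y"
      by (rule exI[of _ "2 * exp (- pi * w\<^sup>2)"]) (simp add: E_fun_has_real_derivative[simplified])
  qed
  show "0 \<le> E_fun z" using mono[OF assms] by (simp add: E_fun_0)
  show "E_fun z \<le> 1"
    by (rule tendsto_lowerbound[OF E_fun_at_top eventually_at_top_linorderI[of z]]) (auto intro: mono)
qed

text \<open>On [0, 1] the factor \<open>exp pi\<close> makes the right-hand side at least 1; beyond
  1 a monotonicity argument applies.\<close>

lemma one_minus_E_fun_le: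
  assumes "z \<ge> 0"
  shows "1 - E_fun z \<le> exp pi * exp (- pi * z\<^sup>2)"
proof (cases "z \<le> 1")
  case True
  have "z\<^sup>2 \<le> 1" using True assms by (simp add: power_le_one)
  hence "pi * z\<^sup>2 \<le> pi" by (simp add: pi_ge_zero mult_left_le)
  hence "1 \<le> exp pi * exp (- pi * z\<^sup>2)" by (simp flip: exp_add)
  thus ?thesis using E_fun_bounds[OF assms] by linarith
next
  case False
  \<comment> \<open>The derivative of the correction term turns that of \<open>E_fun\<close> into a
    multiple of 1 - z, so \<open>?psi\<close> decreases beyond 1 towards its limit 1 and stays at
    least 1 there.\<close>
  let ?psi = "\<lambda>z. E_fun z + exp (- pi * z\<^sup>2) / pi"
  have der: "(?psi has_real_derivative 2 * exp (- pi * z\<^sup>2) * (1 - z)) (at z)" for z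
    by (auto intro!: derivative_eq_intros E_fun_has_real_derivative simp: algebra_simps)
  have "?psi y \<le> ?psi z" if "z \<le> y" for y
  proof (rule DERIV_nonpos_imp_nonincreasing[OF that])
    fix x assume "z \<le> x"
    thus "\<exists>y. (?psi has_real_derivative y) (at x) \<and> y \<le> 0"
      using der[of x] False by (auto intro!: exI[of _ "2 * exp (- pi * x\<^sup>2) * (1 - x)"] mult_nonneg_nonpos)
  qed
  moreover have "((\<lambda>y::real. exp (- pi * y\<^sup>2) / pi) \<longlongrightarrow> 0) at_top" by real_asymp
  from tendsto_add[OF E_fun_at_top this] have "(?psi \<longlongrightarrow> 1) at_top" by simp
  ultimately have "1 \<le> ?psi z"
    by (intro tendsto_upperbound[of ?psi 1 at_top] eventually_at_top_linorderI[of z]) auto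
  moreover have "exp (- pi * z\<^sup>2) / pi \<le> exp (- pi * z\<^sup>2) / 1"
    using pi_gt3 by (intro divide_left_mono) auto
  moreover have "exp (- pi * z\<^sup>2) \<le> exp pi * exp (- pi * z\<^sup>2)"
    by simp
  ultimately show ?thesis by linarith
qed

text \<open>The rate pi is weakened to 3/4 pi so that one Gaussian serves here and for the
  derivatives, whose polynomial factors cost pi/4.\<close>

lemma E_fun_minus_sgn_le:
  "\<bar>E_fun z - sgn_neg z\<bar> \<le> exp pi * exp (- (3/4) * pi * z\<^sup>2)"
proof -
  have "\<bar>E_fun z - sgn_neg z\<bar> \<le> exp pi * exp (- pi * z\<^sup>2)"
    using one_minus_E_fun_le[of z] one_minus_E_fun_le[of "- z"] E_fun_bounds[of z] E_fun_bounds[of "- z"]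
    by (cases "z > 0") (auto simp: sgn_neg_def E_fun_minus)
  also have "\<dots> \<le> exp pi * exp (- (3/4) * pi * z\<^sup>2)" by simp
  finally show ?thesis .
qed

text \<open>Each differentiation replaces the polynomial factor p by p' - 2 pi z p.\<close>

lemma E_fun_derivs:
  "\<exists>p. (deriv ^^ Suc k) E_fun = (\<lambda>z. poly p z * exp (- pi * z\<^sup>2))"
proof (induction k)
  case 0
  have "deriv E_fun z = 2 * exp (- pi * z\<^sup>2)" for z
    by (rule DERIV_imp_deriv E_fun_has_real_derivative)+
  thus ?case by (intro exI[of _ "[:2:]"]) (auto simp: fun_eq_iff)
next
  case (Suc k)
  then obtain p where p: "(deriv ^^ Suc k) E_fun = (\<lambda>z. poly p z * exp (- pi * z\<^sup>2))" by blast
  have "deriv (\<lambda>z. poly p z * exp (- pi * z\<^sup>2)) z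
      = poly (pderiv p - [:0, 2 * pi:] * p) z * exp (- pi * z\<^sup>2)" for z
    by (rule DERIV_imp_deriv) (auto intro!: derivative_eq_intros poly_DERIV simp: algebra_simps)
  hence "(deriv ^^ Suc (Suc k)) E_fun = (\<lambda>z. poly (pderiv p - [:0, 2 * pi:] * p) z * exp (- pi * z\<^sup>2))"
    by (subst funpow.simps(2)) (auto simp only: o_def p)
  thus ?case by blast
qed

text \<open>Induction in Horner form: half of \<open>e\<close> pays for the factor z, the other half
  for the remaining polynomial, which is why \<open>e\<close> varies in the induction.\<close>

lemma poly_le_exp_square:
  fixes p :: "real poly"
  assumes "e > 0"
  shows "\<exists>K. \<forall>z. \<bar>poly p z\<bar> \<le> K * exp (e * z\<^sup>2)"
  using assms
proof (induction p arbitrary: e rule: pCons_induct)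
  case 0
  show ?case by (auto intro: exI[of _ 0])
next
  case (pCons a p)
  obtain K where K: "\<And>z. \<bar>poly p z\<bar> \<le> K * exp (e / 2 * z\<^sup>2)"
    using pCons.IH[of "e/2"] pCons.prems by auto
  have z: "\<bar>z\<bar> \<le> (1 + 2 / e) * exp (e / 2 * z\<^sup>2)" for z
  proof -
    have "2 * \<bar>z\<bar> \<le> 1 + z\<^sup>2" using sum_squares_bound[of 1 "\<bar>z\<bar>"] by simp
    hence "\<bar>z\<bar> \<le> 1 + z\<^sup>2" by simp
    also have "\<dots> \<le> (1 + 2 / e) * (1 + e / 2 * z\<^sup>2)" using pCons.prems by (simp add: field_simps)
    also have "\<dots> \<le> (1 + 2 / e) * exp (e / 2 * z\<^sup>2)"
      using pCons.prems by (intro mult_left_mono exp_ge_add_one_self) auto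
    finally show ?thesis .
  qed
  have "\<bar>poly (pCons a p) z\<bar> \<le> (\<bar>a\<bar> + (1 + 2 / e) * K) * exp (e * z\<^sup>2)" for z
  proof -
    have "\<bar>poly (pCons a p) z\<bar> \<le> \<bar>a\<bar> * 1 + \<bar>z\<bar> * \<bar>poly p z\<bar>"
      by (simp add: abs_mult[symmetric] abs_triangle_ineq)
    also have "\<dots> \<le> \<bar>a\<bar> * exp (e * z\<^sup>2) + ((1 + 2 / e) * exp (e / 2 * z\<^sup>2)) * (K * exp (e / 2 * z\<^sup>2))"
      using pCons.prems by (intro add_mono mult_mono K z) auto
    also have "((1 + 2 / e) * exp (e / 2 * z\<^sup>2)) * (K * exp (e / 2 * z\<^sup>2))
       = (1 + 2 / e) * K * (exp (e / 2 * z\<^sup>2) * exp (e / 2 * z\<^sup>2))" by (simp only: mult_ac)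
    also have "exp (e / 2 * z\<^sup>2) * exp (e / 2 * z\<^sup>2) = exp (e * z\<^sup>2)" by (simp flip: exp_add)
    finally show ?thesis by (simp add: algebra_simps)
  qed
  thus ?case by blast
qed

lemma E_fun_derivs_le:
  "\<exists>K. \<forall>z. \<bar>(deriv ^^ Suc k) E_fun z\<bar> \<le> K * exp (- (3/4) * pi * z\<^sup>2)"
proof -
  obtain p where p: "(deriv ^^ Suc k) E_fun = (\<lambda>z. poly p z * exp (- pi * z\<^sup>2))"
    using E_fun_derivs by blast
  obtain K where K: "\<And>z. \<bar>poly p z\<bar> \<le> K * exp (pi / 4 * z\<^sup>2)"
    using poly_le_exp_square[of "pi/4" p] by auto
  have "\<bar>poly p z * exp (- pi * z\<^sup>2)\<bar> \<le> K * exp (- (3/4) * pi * z\<^sup>2)" for z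
  proof -
    have "\<bar>poly p z * exp (- pi * z\<^sup>2)\<bar> \<le> K * exp (pi / 4 * z\<^sup>2) * exp (- pi * z\<^sup>2)"
      unfolding abs_mult abs_exp_cancel by (intro mult_right_mono K) auto
    also have "\<dots> = K * exp (pi / 4 * z\<^sup>2 + - pi * z\<^sup>2)" by (simp only: exp_add mult_ac)
    also have "pi / 4 * z\<^sup>2 + - pi * z\<^sup>2 = - (3/4) * pi * z\<^sup>2" by simp
    finally show ?thesis .
  qed
  thus ?thesis unfolding p by blast
qed

section \<open>Factorization over the coordinate pairs\<close>

text \<open>\<open>mono_del u w k \<alpha> \<beta>\<close> is the \<open>k\<close>-th power of \<open>u \<partial>\<^sub>x + w \<partial>\<^sub>y\<close>
  applied to \<open>x\<^sup>\<alpha> y\<^sup>\<beta>\<close>; the operator is applied to the monomial first, so that only monomials occur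
  in the recursion.\<close>

fun mono_del :: "real \<Rightarrow> real \<Rightarrow> nat \<Rightarrow> nat \<Rightarrow> nat \<Rightarrow> real \<times> real \<Rightarrow> real" where
  "mono_del u w 0 \<alpha> \<beta> x = fst x ^ \<alpha> * snd x ^ \<beta>"
| "mono_del u w (Suc k) \<alpha> \<beta> x =
     u * real \<alpha> * mono_del u w k (\<alpha> - 1) \<beta> x + w * real \<beta> * mono_del u w k \<alpha> (\<beta> - 1) x"

text \<open>Partial derivatives commute with the operator, so the derivative is the operator applied
  to another monomial. For \<alpha> = 0 the truncated \<open>\<alpha> - 1\<close> is harmless, since
  the factor \<open>real \<alpha>\<close> is 0.\<close>

lemma mono_del_has_derivative_fst:
  "((\<lambda>s. mono_del u w k \<alpha> \<beta> (s, y)) has_real_derivative real \<alpha> * mono_del u w k (\<alpha> - 1) \<beta> (s, y)) (at s)"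
proof (induction k arbitrary: \<alpha> \<beta>)
  case 0
  show ?case by (auto intro!: derivative_eq_intros)
next
  case (Suc k)
  show ?case
    using DERIV_add[OF DERIV_cmult[OF Suc.IH, of "u * real \<alpha>" "\<alpha> - 1" \<beta>]
        DERIV_cmult[OF Suc.IH, of "w * real \<beta>" \<alpha> "\<beta> - 1"]]
    by (simp add: algebra_simps)
qed

lemma mono_del_has_derivative_snd:
  "((\<lambda>s. mono_del u w k \<alpha> \<beta> (x, s)) has_real_derivative real \<beta> * mono_del u w k \<alpha> (\<beta> - 1) (x, s)) (at s)"
proof (induction k arbitrary: \<alpha> \<beta>)
  case 0
  show ?case by (auto intro!: derivative_eq_intros)
next
  case (Suc k)
  show ?case
    using DERIV_add[OF DERIV_cmult[OF Suc.IH, of "u * real \<alpha>" "\<alpha> - 1" \<beta>]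
        DERIV_cmult[OF Suc.IH, of "w * real \<beta>" \<alpha> "\<beta> - 1"]]
    by (simp add: algebra_simps)
qed

text \<open>Each application lowers the degree by one; an exponent 0, which cannot drop, comes with
  coefficient 0.\<close>

lemma mono_del_eq_0: "\<alpha> + \<beta> < k \<Longrightarrow> mono_del u w k \<alpha> \<beta> x = 0"
proof (induction k arbitrary: \<alpha> \<beta>)
  case (Suc k)
  have "real \<alpha> * mono_del u w k (\<alpha> - 1) \<beta> x = 0"
    using Suc by (cases "\<alpha> = 0") auto
  moreover have "real \<beta> * mono_del u w k \<alpha> (\<beta> - 1) x = 0"
    using Suc by (cases "\<beta> = 0") auto
  ultimately show ?case by (auto simp: mult.assoc)
qed simp

text \<open>Each application costs a factor of at most L (\<alpha> + \<beta>) and never raises the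
  degree. As the base 1 + |x| + |y| is at least 1, monomials of lower degree obey the same
  bound.\<close>

lemma mono_del_le:
  assumes "\<bar>u\<bar> \<le> L" "\<bar>w\<bar> \<le> L"
  shows "\<bar>mono_del u w k \<alpha> \<beta> x\<bar> \<le> (L * real (\<alpha> + \<beta>)) ^ k * (1 + \<bar>fst x\<bar> + \<bar>snd x\<bar>) ^ (\<alpha> + \<beta>)"
proof (induction k arbitrary: \<alpha> \<beta>)
  case 0
  show ?case
    by (auto simp: abs_mult power_abs power_add intro!: mult_mono power_mono)
next
  case (Suc k)
  let ?W = "1 + \<bar>fst x\<bar> + \<bar>snd x\<bar>"
  let ?B = "(L * real (\<alpha> + \<beta>)) ^ k * ?W ^ (\<alpha> + \<beta>)"
  have L: "0 \<le> L" using assms by linarith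
  have step: "(L * real n) ^ k * ?W ^ n \<le> ?B" if "n \<le> \<alpha> + \<beta>" for n
    using that L by (intro mult_mono power_mono power_increasing mult_left_mono) auto
  have "\<bar>mono_del u w k (\<alpha> - 1) \<beta> x\<bar> \<le> ?B" "\<bar>mono_del u w k \<alpha> (\<beta> - 1) x\<bar> \<le> ?B"
    by (rule order_trans[OF Suc.IH step], simp)+
  hence "\<bar>u\<bar> * real \<alpha> * \<bar>mono_del u w k (\<alpha> - 1) \<beta> x\<bar> + \<bar>w\<bar> * real \<beta> * \<bar>mono_del u w k \<alpha> (\<beta> - 1) x\<bar>
      \<le> L * real \<alpha> * ?B + L * real \<beta> * ?B"
    using assms L by (intro add_mono mult_mono) auto
  moreover have "\<bar>mono_del u w (Suc k) \<alpha> \<beta> x\<bar> \<le>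
      \<bar>u\<bar> * real \<alpha> * \<bar>mono_del u w k (\<alpha> - 1) \<beta> x\<bar> + \<bar>w\<bar> * real \<beta> * \<bar>mono_del u w k \<alpha> (\<beta> - 1) x\<bar>"
    by (simp add: order_trans[OF abs_triangle_ineq] abs_mult)
  ultimately show ?case by (simp add: algebra_simps)
qed

text \<open>For cusps the value does not depend on \<open>k\<close>, because \<open>del\<close> is then the identity.\<close>

definition cone_mono_del :: "real \<times> real \<Rightarrow> nat \<Rightarrow> nat \<Rightarrow> nat \<Rightarrow> real \<times> real \<Rightarrow> real" where
  "cone_mono_del c k \<alpha> \<beta> =
     (if c \<in> C_cone then mono_del (fst c / sqrt (- Q1 c)) (snd c / sqrt (- Q1 c)) k \<alpha> \<beta>
      else mono_del 0 0 0 \<alpha> \<beta>)"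

definition mono_del_prod ::
  "('m \<Rightarrow> real \<times> real) \<Rightarrow> ('m \<Rightarrow> nat) \<Rightarrow> ('m \<Rightarrow> nat) \<times> ('m \<Rightarrow> nat) \<Rightarrow> 'm::finite space \<Rightarrow> real" where
  "mono_del_prod c \<kappa> p x = (\<Prod>j\<in>UNIV. cone_mono_del (c j) (\<kappa> j) (fst p j) (snd p j) (x $ j))"

lemma prod_split_at: "(\<Prod>i\<in>UNIV. h i) = h j * (\<Prod>i\<in>UNIV - {j}. h i)"
  for h :: "'m::finite \<Rightarrow> real"
  by (rule prod.remove) auto

text \<open>Moving along axis \<open>j\<close> affects only the \<open>j\<close>-th factor; the
  others form a constant.\<close>

lemma sum_mono_del_prod_has_vector_derivative:
  fixes x :: "'m::finite space" and coef :: "_ \<Rightarrow> complex"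
  assumes "\<And>p. p \<in> A \<Longrightarrow> ((\<lambda>t. cone_mono_del (c j) (\<kappa> j) (fst p j) (snd p j) (x $ j + t *\<^sub>R v))
      has_real_derivative D p) (at 0)"
  shows "((\<lambda>t. \<Sum>p\<in>A. coef p * of_real (mono_del_prod c \<kappa> p (x + t *\<^sub>R axis j v))) has_vector_derivative
      (\<Sum>p\<in>A. coef p * of_real (D p *
         (\<Prod>i\<in>UNIV - {j}. cone_mono_del (c i) (\<kappa> i) (fst p i) (snd p i) (x $ i))))) (at 0)"
proof (rule has_vector_derivative_sum)
  fix p assume p: "p \<in> A"
  let ?R = "\<Prod>i\<in>UNIV - {j}. cone_mono_del (c i) (\<kappa> i) (fst p i) (snd p i) (x $ i)"
  have eq: "mono_del_prod c \<kappa> p (x + t *\<^sub>R axis j v) =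
      cone_mono_del (c j) (\<kappa> j) (fst p j) (snd p j) (x $ j + t *\<^sub>R v) * ?R" for t
    unfolding mono_del_prod_def by (subst prod_split_at[of _ j]) (simp add: axis_def)
  have "((\<lambda>t. cone_mono_del (c j) (\<kappa> j) (fst p j) (snd p j) (x $ j + t *\<^sub>R v) * ?R)
      has_real_derivative D p * ?R) (at 0)"
    by (rule DERIV_cmult_right assms p)+
  hence "((\<lambda>t. mono_del_prod c \<kappa> p (x + t *\<^sub>R axis j v)) has_real_derivative D p * ?R) (at 0)"
    unfolding eq .
  from has_vector_derivative_mult_right[OF has_vector_derivative_of_real[OF this]]
  show "((\<lambda>t. coef p * of_real (mono_del_prod c \<kappa> p (x + t *\<^sub>R axis j v))) has_vector_derivative
      coef p * of_real (D p * ?R)) (at 0)" .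
qed

text \<open>Formulated for whole sums because \<open>del\<close>, built from
  \<open>vector_derivative\<close>, is linear only on differentiable functions. At a cusp neither
  side depends on \<open>\<kappa> j\<close>.\<close>

lemma del_sum_mono_del_prod:
  fixes coef :: "_ \<Rightarrow> complex" and c :: "'m::finite \<Rightarrow> real \<times> real"
  shows "del (c j) j (\<lambda>x. \<Sum>p\<in>A. coef p * of_real (mono_del_prod c \<kappa> p x)) =
     (\<lambda>x. \<Sum>p\<in>A. coef p * of_real (mono_del_prod c (\<kappa>(j := Suc (\<kappa> j))) p x))"
proof (cases "c j \<in> C_cone")
  case False
  have "mono_del_prod c (\<kappa>(j := Suc (\<kappa> j))) p x = mono_del_prod c \<kappa> p x" for p x
    unfolding mono_del_prod_def by (rule prod.cong) (auto simp: cone_mono_del_def False)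
  thus ?thesis by (simp add: del_def False)
next
  case True
  define u where "u = fst (c j) / sqrt (- Q1 (c j))"
  define w where "w = snd (c j) / sqrt (- Q1 (c j))"
  have cm: "cone_mono_del (c j) k = mono_del u w k" for k
    by (simp add: fun_eq_iff cone_mono_del_def True u_def w_def)
  let ?F = "\<lambda>x. \<Sum>p\<in>A. coef p * of_real (mono_del_prod c \<kappa> p x)"
  let ?R = "\<lambda>p x. \<Prod>i\<in>UNIV - {j}. cone_mono_del (c i) (\<kappa> i) (fst p i) (snd p i) (x $ i)"
  have dx: "dX j ?F x = (\<Sum>p\<in>A. coef p * of_real
      (real (fst p j) * mono_del u w (\<kappa> j) (fst p j - 1) (snd p j) (x $ j) * ?R p x))" for x
    unfolding dX_def
  proof (rule vector_derivative_at, rule sum_mono_del_prod_has_vector_derivative)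
    fix p
    have "((\<lambda>t. mono_del u w (\<kappa> j) (fst p j) (snd p j) (fst (x $ j) + t, snd (x $ j))) has_real_derivative
       real (fst p j) * mono_del u w (\<kappa> j) (fst p j - 1) (snd p j) (fst (x $ j) + 0, snd (x $ j)) * 1) (at 0)"
      by (rule DERIV_chain2[OF mono_del_has_derivative_fst]) (auto intro!: derivative_eq_intros)
    moreover have "x $ j + t *\<^sub>R (1, 0) = (fst (x $ j) + t, snd (x $ j))" for t
      by (simp add: prod_eq_iff)
    ultimately show "((\<lambda>t. cone_mono_del (c j) (\<kappa> j) (fst p j) (snd p j) (x $ j + t *\<^sub>R (1, 0))) has_real_derivative
       real (fst p j) * mono_del u w (\<kappa> j) (fst p j - 1) (snd p j) (x $ j)) (at 0)"
      by (simp add: cm)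
  qed
  have dy: "dY j ?F x = (\<Sum>p\<in>A. coef p * of_real
      (real (snd p j) * mono_del u w (\<kappa> j) (fst p j) (snd p j - 1) (x $ j) * ?R p x))" for x
    unfolding dY_def
  proof (rule vector_derivative_at, rule sum_mono_del_prod_has_vector_derivative)
    fix p
    have "((\<lambda>t. mono_del u w (\<kappa> j) (fst p j) (snd p j) (fst (x $ j), snd (x $ j) + t)) has_real_derivative
       real (snd p j) * mono_del u w (\<kappa> j) (fst p j) (snd p j - 1) (fst (x $ j), snd (x $ j) + 0) * 1) (at 0)"
      by (rule DERIV_chain2[OF mono_del_has_derivative_snd]) (auto intro!: derivative_eq_intros)
    moreover have "x $ j + t *\<^sub>R (0, 1) = (fst (x $ j), snd (x $ j) + t)" for t
      by (simp add: prod_eq_iff)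
    ultimately show "((\<lambda>t. cone_mono_del (c j) (\<kappa> j) (fst p j) (snd p j) (x $ j + t *\<^sub>R (0, 1))) has_real_derivative
       real (snd p j) * mono_del u w (\<kappa> j) (fst p j) (snd p j - 1) (x $ j)) (at 0)"
      by (simp add: cm)
  qed
  have Suc: "mono_del_prod c (\<kappa>(j := Suc (\<kappa> j))) p x =
      u * (real (fst p j) * mono_del u w (\<kappa> j) (fst p j - 1) (snd p j) (x $ j) * ?R p x) +
      w * (real (snd p j) * mono_del u w (\<kappa> j) (fst p j) (snd p j - 1) (x $ j) * ?R p x)" for p x
    unfolding mono_del_prod_def by (subst prod_split_at[of _ j]) (simp add: cm algebra_simps)
  have "del (c j) j ?F x = of_real u * dX j ?F x + of_real w * dY j ?F x" for x
    using True by (simp add: del_def u_def w_def scaleR_conv_of_real algebra_simps)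
  thus ?thesis
    by (simp add: fun_eq_iff dx dy Suc sum_distrib_left sum.distrib algebra_simps)
qed

lemma del_funpow_sum_mono_del_prod:
  fixes coef :: "_ \<Rightarrow> complex" and c :: "'m::finite \<Rightarrow> real \<times> real"
  shows "(del (c j) j ^^ n) (\<lambda>x. \<Sum>p\<in>A. coef p * of_real (mono_del_prod c \<kappa> p x)) =
     (\<lambda>x. \<Sum>p\<in>A. coef p * of_real (mono_del_prod c (\<kappa>(j := \<kappa> j + n)) p x))"
proof (induction n)
  case (Suc n)
  have "(del (c j) j ^^ Suc n) (\<lambda>x. \<Sum>p\<in>A. coef p * of_real (mono_del_prod c \<kappa> p x)) =
      del (c j) j (\<lambda>x. \<Sum>p\<in>A. coef p * of_real (mono_del_prod c (\<kappa>(j := \<kappa> j + n)) p x))"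
    by (simp only: funpow.simps(2) o_def Suc)
  thus ?case by (simp only: del_sum_mono_del_prod fun_upd_same fun_upd_upd add_Suc_right)
qed simp

lemma del_prod_sum_mono_del_prod:
  fixes coef :: "_ \<Rightarrow> complex" and c :: "'m::{finite,linorder} \<Rightarrow> real \<times> real"
  shows "del_prod c \<kappa> (\<lambda>x. \<Sum>p\<in>A. coef p * of_real (mono_del_prod c (\<lambda>_. 0) p x)) =
     (\<lambda>x. \<Sum>p\<in>A. coef p * of_real (mono_del_prod c \<kappa> p x))"
proof -
  \<comment> \<open>\<open>foldr\<close> works from the right: the indices already met carry their
    final exponent, all others 0. Distinctness ensures that the next index still has exponent
    0.\<close>
  have "foldr (\<lambda>j. del (c j) j ^^ \<kappa> j) js (\<lambda>x. \<Sum>p\<in>A. coef p * of_real (mono_del_prod c (\<lambda>_. 0) p x)) =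
      (\<lambda>x. \<Sum>p\<in>A. coef p * of_real (mono_del_prod c (\<lambda>j. if j \<in> set js then \<kappa> j else 0) p x))"
    if "distinct js" for js
    using that
  proof (induction js)
    case (Cons j js)
    have "(\<lambda>i. if i \<in> set js then \<kappa> i else 0)(j := (if j \<in> set js then \<kappa> j else 0) + \<kappa> j) =
        (\<lambda>i. if i \<in> set (j # js) then \<kappa> i else 0)"
      using Cons.prems by (auto simp: fun_eq_iff)
    thus ?case using Cons by (simp add: del_funpow_sum_mono_del_prod)
  qed simp
  from this[of "sorted_list_of_set UNIV"] show ?thesis
    by (simp add: del_prod_def)
qed

text \<open>The contribution of one pair \<open>(x\<^sub>j, y\<^sub>j)\<close> and one vector \<open>c\<close> to \<open>p_fun\<close> of a monomial. Here \<open>k\<close>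
  runs up to the total degree \<open>d\<close>; the terms beyond the degree of the monomial vanish, which is what
  turns the sum over \<open>|\<kappa>| \<le> d\<close> into a sum over a box and thus into a product.\<close>

definition p_component :: "nat \<Rightarrow> real \<times> real \<Rightarrow> nat \<Rightarrow> nat \<Rightarrow> real \<times> real \<Rightarrow> real" where
  "p_component d c \<alpha> \<beta> x =
     (\<Sum>k\<le>d. (- 1 / (4 * pi)) ^ k * (rho c k x / fact k) * cone_mono_del c k \<alpha> \<beta> x)"

text \<open>At a cusp \<open>rho\<close> vanishes because \<open>k\<close> is positive; in the cone
  the order of the operator exceeds the degree.\<close>

lemma rho_times_cone_mono_del_eq_0:
  "\<alpha> + \<beta> < k \<Longrightarrow> rho c k x = 0 \<or> cone_mono_del c k \<alpha> \<beta> x = 0"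
  by (auto simp: rho_def cone_mono_del_def mono_del_eq_0)

text \<open>A sum of products becomes a product of sums twice: over the multi-indices, after
  enlarging their range to a box, and over the sign vectors.\<close>

lemma p_fun_eq_prod_components:
  fixes x c0 c1 :: "'m::{finite,linorder} space" and d :: nat
    and coef :: "('m \<Rightarrow> nat) \<times> ('m \<Rightarrow> nat) \<Rightarrow> complex"
  defines "A \<equiv> {p :: ('m \<Rightarrow> nat) \<times> ('m \<Rightarrow> nat). (\<Sum>j\<in>UNIV. fst p j + snd p j) = d}"
  shows "p_fun d c0 c1 (\<lambda>x. \<Sum>p\<in>A. coef p * of_real (\<Prod>j\<in>UNIV. fst (x $ j) ^ fst p j * snd (x $ j) ^ snd p j)) x
    = (\<Sum>p\<in>A. coef p * of_real (\<Prod>j\<in>UNIV. p_component d (c0 $ j) (fst p j) (snd p j) (x $ j)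
                                       - p_component d (c1 $ j) (fst p j) (snd p j) (x $ j)))"
    (is "p_fun d c0 c1 ?f x = _")
proof -
  \<comment> \<open>At order 0 \<open>cone_mono_del\<close> is the plain monomial for every vector,
    so this form of \<open>?f\<close> is available for each choice of signs.\<close>
  have f: "?f = (\<lambda>x. \<Sum>p\<in>A. coef p * of_real (mono_del_prod c (\<lambda>_. 0) p x))" for c
    unfolding mono_del_prod_def cone_mono_del_def if_distribR mono_del.simps if_cancel ..
  have inner: "(\<Sum>k = 0..d. (- 1) ^ k / of_real ((4 * pi) ^ k) *
           (\<Sum>\<kappa> \<in> {\<kappa> :: 'm \<Rightarrow> nat. (\<Sum>j\<in>UNIV. \<kappa> j) = k}.
              of_real (\<Prod>j\<in>UNIV. rho (c j) (\<kappa> j) (x $ j) / fact (\<kappa> j)) * del_prod c \<kappa> ?f x))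
        = (\<Sum>p\<in>A. coef p * of_real (\<Prod>j\<in>UNIV. p_component d (c j) (fst p j) (snd p j) (x $ j)))"
    for c :: "'m \<Rightarrow> real \<times> real"
  proof -
    define g where "g p j k = (- 1 / (4 * pi)) ^ k * (rho (c j) k (x $ j) / fact k) *
        cone_mono_del (c j) k (fst p j) (snd p j) (x $ j)" for p :: "('m \<Rightarrow> nat) \<times> ('m \<Rightarrow> nat)" and j k
    let ?S = "{\<kappa> :: 'm \<Rightarrow> nat. (\<Sum>j\<in>UNIV. \<kappa> j) \<le> d}"
    have S_sub: "?S \<subseteq> PiE UNIV (\<lambda>_. {..d})"
    proof
      fix \<kappa> :: "'m \<Rightarrow> nat" assume "\<kappa> \<in> ?S"
      hence "\<kappa> j \<le> d" for j using member_le_sum[of j UNIV \<kappa>] by simp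
      thus "\<kappa> \<in> PiE UNIV (\<lambda>_. {..d})" by (auto simp: PiE_UNIV_domain)
    qed
    hence fin: "finite ?S" by (rule finite_subset) (simp add: finite_PiE)
    have coeff: "(- 1) ^ k / of_real ((4 * pi) ^ k) *
        (of_real (\<Prod>j\<in>UNIV. rho (c j) (\<kappa> j) (x $ j) / fact (\<kappa> j)) * del_prod c \<kappa> ?f x)
        = (\<Sum>p\<in>A. coef p * of_real (\<Prod>j\<in>UNIV. g p j (\<kappa> j)))"
      if k: "(\<Sum>j\<in>UNIV. \<kappa> j) = k" for k and \<kappa> :: "'m \<Rightarrow> nat"
    proof -
      have c: "(- 1) ^ k / of_real ((4 * pi) ^ k) = complex_of_real (\<Prod>j\<in>UNIV. (- 1 / (4 * pi)) ^ \<kappa> j)"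
        unfolding power_sum[symmetric] k
        by (simp only: power_divide of_real_divide of_real_power of_real_minus of_real_1)
      have g: "(\<Prod>j\<in>UNIV. g p j (\<kappa> j)) = (\<Prod>j\<in>UNIV. (- 1 / (4 * pi)) ^ \<kappa> j) *
          (\<Prod>j\<in>UNIV. rho (c j) (\<kappa> j) (x $ j) / fact (\<kappa> j)) * mono_del_prod c \<kappa> p x" for p
        unfolding g_def prod.distrib mono_del_prod_def ..
      show ?thesis
        unfolding f[of c] del_prod_sum_mono_del_prod c g of_real_mult sum_distrib_left
        by (intro sum.cong refl) (simp only: mult_ac)
    qed
    have "(\<Sum>k = 0..d. (- 1) ^ k / of_real ((4 * pi) ^ k) *
           (\<Sum>\<kappa> \<in> {\<kappa> :: 'm \<Rightarrow> nat. (\<Sum>j\<in>UNIV. \<kappa> j) = k}.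
              of_real (\<Prod>j\<in>UNIV. rho (c j) (\<kappa> j) (x $ j) / fact (\<kappa> j)) * del_prod c \<kappa> ?f x))
       = (\<Sum>k = 0..d. \<Sum>\<kappa> \<in> {\<kappa> \<in> ?S. (\<Sum>j\<in>UNIV. \<kappa> j) = k}. \<Sum>p\<in>A. coef p * of_real (\<Prod>j\<in>UNIV. g p j (\<kappa> j)))"
      unfolding sum_distrib_left by (intro sum.cong coeff) auto
    also have "\<dots> = (\<Sum>\<kappa>\<in>?S. \<Sum>p\<in>A. coef p * of_real (\<Prod>j\<in>UNIV. g p j (\<kappa> j)))"
      by (rule sum.group[OF fin]) auto
    also have "\<dots> = (\<Sum>p\<in>A. coef p * of_real (\<Sum>\<kappa>\<in>?S. \<Prod>j\<in>UNIV. g p j (\<kappa> j)))"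
      by (subst sum.swap) (simp add: sum_distrib_left)
    also have "\<dots> = (\<Sum>p\<in>A. coef p * of_real (\<Prod>j\<in>UNIV. p_component d (c j) (fst p j) (snd p j) (x $ j)))"
    proof (rule sum.cong[OF refl])
      fix p assume p: "p \<in> A"
      have "(\<Sum>\<kappa>\<in>?S. \<Prod>j\<in>UNIV. g p j (\<kappa> j)) = (\<Sum>\<kappa>\<in>PiE UNIV (\<lambda>_. {..d}). \<Prod>j\<in>UNIV. g p j (\<kappa> j))"
      proof (rule sum.mono_neutral_left[OF _ S_sub])
        show "\<forall>\<kappa>\<in>PiE UNIV (\<lambda>_. {..d}) - ?S. (\<Prod>j\<in>UNIV. g p j (\<kappa> j)) = 0"
        proof
          fix \<kappa> :: "'m \<Rightarrow> nat" assume "\<kappa> \<in> PiE UNIV (\<lambda>_. {..d}) - ?S"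
          \<comment> \<open>Outside \<open>?S\<close> the sum of \<open>\<kappa>\<close> exceeds the
            total degree \<open>d\<close> of the monomial, hence some entry exceeds the degree of
            its own factor.\<close>
          hence "(\<Sum>j\<in>UNIV. fst p j + snd p j) < (\<Sum>j\<in>UNIV. \<kappa> j)" using p by (auto simp: A_def)
          hence "\<exists>j. fst p j + snd p j < \<kappa> j"
            by (meson leD leI sum_mono)
          then obtain j where "fst p j + snd p j < \<kappa> j" ..
          hence "g p j (\<kappa> j) = 0"
            using rho_times_cone_mono_del_eq_0[of "fst p j" "snd p j" "\<kappa> j" "c j" "x $ j"] by (auto simp: g_def)
          thus "(\<Prod>j\<in>UNIV. g p j (\<kappa> j)) = 0" by (intro prod_zero) auto
        qed
      qed (simp add: finite_PiE)
      also have "\<dots> = (\<Prod>j\<in>UNIV. \<Sum>k\<in>{..d}. g p j k)"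
        by (rule prod_sum_PiE[symmetric]) auto
      finally show "coef p * of_real (\<Sum>\<kappa>\<in>?S. \<Prod>j\<in>UNIV. g p j (\<kappa> j))
          = coef p * of_real (\<Prod>j\<in>UNIV. p_component d (c j) (fst p j) (snd p j) (x $ j))"
        by (simp add: g_def p_component_def)
    qed
    finally show ?thesis .
  qed
  \<comment> \<open>The global sign is distributed over the coordinates, so that summing over 0 and
    1 in each coordinate yields a difference.\<close>
  define h where "h p j s = (- 1) ^ s * p_component d (if s = 0 then c0 $ j else c1 $ j) (fst p j) (snd p j) (x $ j)"
    for p :: "('m \<Rightarrow> nat) \<times> ('m \<Rightarrow> nat)" and j and s :: nat
  have signs: "{\<sigma> :: 'm \<Rightarrow> nat. \<forall>j. \<sigma> j \<in> {0, 1}} = PiE UNIV (\<lambda>_. {0, 1})"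
    by (auto simp: PiE_UNIV_domain Pi_def)
  have "p_fun d c0 c1 ?f x = (\<Sum>\<sigma>\<in>PiE UNIV (\<lambda>_. {0, 1}). \<Sum>p\<in>A. coef p * of_real (\<Prod>j\<in>UNIV. h p j (\<sigma> j)))"
    unfolding p_fun_def inner signs
    by (intro sum.cong refl)
       (simp add: sum_distrib_left h_def prod.distrib select_def power_sum mult_ac)
  also have "\<dots> = (\<Sum>p\<in>A. coef p * of_real (\<Sum>\<sigma>\<in>PiE UNIV (\<lambda>_. {0, 1}). \<Prod>j\<in>UNIV. h p j (\<sigma> j)))"
    by (subst sum.swap) (simp add: sum_distrib_left)
  also have "\<dots> = (\<Sum>p\<in>A. coef p * of_real (\<Prod>j\<in>UNIV. \<Sum>s\<in>{0, 1}. h p j s))"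
    by (subst prod_sum_PiE[symmetric]) auto
  finally show ?thesis by (simp add: h_def)
qed

section \<open>Uniform bounds in dimension two\<close>

text \<open>The n-th power of 1 + r \<le> (1 + n/e) exp (e r / n), where the constant 1 + n/e is
  chosen to fit the tangent bound 1 + t \<le> exp t.\<close>

lemma power_le_exp_mult:
  fixes e :: real
  assumes "e > 0"
  shows "\<exists>K\<ge>0. \<forall>r\<ge>0. (1 + r) ^ n \<le> K * exp (e * r)"
proof (cases "n = 0")
  case True
  thus ?thesis using assms by (intro exI[of _ 1]) auto
next
  case False
  have "(1 + r) ^ n \<le> (1 + n / e) ^ n * exp (e * r)" if "r \<ge> 0" for r
  proof -
    have "1 + r \<le> (1 + n / e) * (1 + e / n * r)"
      using assms that False by (simp add: field_simps)
    also have "\<dots> \<le> (1 + n / e) * exp (e / n * r)"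
      using assms by (intro mult_left_mono exp_ge_add_one_self) auto
    finally have "(1 + r) ^ n \<le> ((1 + n / e) * exp (e / n * r)) ^ n"
      using that by (intro power_mono) auto
    also have "\<dots> = (1 + n / e) ^ n * exp (e * r)"
      using False by (simp add: power_mult_distrib flip: exp_of_nat_mult)
    finally show ?thesis .
  qed
  thus ?thesis using assms by (intro exI[of _ "(1 + n / e) ^ n"]) auto
qed

text \<open>Up to a positive factor a vector of the cone is \<open>(- 1 / s, s)\<close>, where \<open>s\<close> is its scale.
  The cusps \<open>(0, 1)\<close> and \<open>(- 1, 0)\<close> correspond to \<open>s \<rightarrow> \<infinity>\<close> and \<open>s \<rightarrow> 0\<close>.\<close>

definition cone_scale :: "real \<times> real \<Rightarrow> real" where
  "cone_scale c = sqrt (snd c / - fst c)"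

lemma C_cone_iff: "c \<in> C_cone \<longleftrightarrow> fst c < 0 \<and> 0 < snd c"
  by (auto simp: C_cone_def Q1_def mult_less_0_iff)

lemma cone_scale_pos: "c \<in> C_cone \<Longrightarrow> 0 < cone_scale c"
  unfolding cone_scale_def C_cone_iff by (simp add: divide_pos_neg)

lemma
  assumes "c \<in> C_cone"
  shows fst_over_sqrt_Q1: "fst c / sqrt (- Q1 c) = - 1 / cone_scale c"
    and snd_over_sqrt_Q1: "snd c / sqrt (- Q1 c) = cone_scale c"
    and B1_over_sqrt_Q1: "B1 c x / sqrt (- Q1 c) = cone_scale c * fst x - snd x / cone_scale c"
proof -
  \<comment> \<open>Writing the entries as - p^2 and r^2 removes the nested roots:
    \<open>sqrt (- Q1 c)\<close> is p r and the scale is r / p.\<close>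
  define p r where "p = sqrt (- fst c)" and "r = sqrt (snd c)"
  have pr: "p > 0" "r > 0" "fst c = - p\<^sup>2" "snd c = r\<^sup>2"
    using assms by (auto simp: C_cone_iff p_def r_def)
  have Q: "sqrt (- Q1 c) = p * r"
    using pr by (simp add: Q1_def real_sqrt_mult)
  have s: "cone_scale c = r / p"
    using pr by (simp add: cone_scale_def real_sqrt_divide)
  show 1: "fst c / sqrt (- Q1 c) = - 1 / cone_scale c" and 2: "snd c / sqrt (- Q1 c) = cone_scale c"
    unfolding Q s using pr by (simp_all add: field_simps power2_eq_square)
  have "B1 c x / sqrt (- Q1 c) = fst c / sqrt (- Q1 c) * snd x + snd c / sqrt (- Q1 c) * fst x"
    by (simp add: B1_def add_divide_distrib)
  thus "B1 c x / sqrt (- Q1 c) = cone_scale c * fst x - snd x / cone_scale c"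
    unfolding 1 2 by simp
qed

text \<open>\<open>K\<close> is uniform in \<open>c\<close> because \<open>c\<close> enters only
  through the argument of \<open>E_fun\<close>; dividing by the positive
  \<open>sqrt (- Q1 c)\<close> does not change the sign.\<close>

lemma rho_minus_sgn_le:
  "\<exists>K\<ge>0. \<forall>c\<in>C_cone. \<forall>x. \<bar>rho c k x - (if k = 0 then sgn_neg (B1 c x) else 0)\<bar>
     \<le> K * exp (- (3/4) * pi * (cone_scale c * fst x - snd x / cone_scale c)\<^sup>2)"
proof (cases k)
  case 0
  have "\<bar>rho c 0 x - sgn_neg (B1 c x)\<bar> \<le> exp pi *
      exp (- (3/4) * pi * (cone_scale c * fst x - snd x / cone_scale c)\<^sup>2)" if c: "c \<in> C_cone" for c x
  proof -
    have "sqrt (- Q1 c) > 0" using c by (simp add: C_cone_def)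
    hence "sgn_neg (B1 c x) = sgn_neg (B1 c x / sqrt (- Q1 c))"
      by (auto simp: sgn_neg_def zero_less_divide_iff)
    thus ?thesis
      using E_fun_minus_sgn_le[of "B1 c x / sqrt (- Q1 c)"] c
      by (simp add: rho_def B1_over_sqrt_Q1)
  qed
  thus ?thesis unfolding 0 by (intro exI[of _ "exp pi"]) auto
next
  case (Suc l)
  obtain K where K: "\<And>z. \<bar>(deriv ^^ Suc l) E_fun z\<bar> \<le> K * exp (- (3/4) * pi * z\<^sup>2)"
    using E_fun_derivs_le by blast
  have "0 \<le> K * exp 0" using K[of 0] by (intro order_trans[OF abs_ge_zero]) auto
  thus ?thesis using K unfolding Suc
    by (intro exI[of _ K]) (auto simp: rho_def B1_over_sqrt_Q1 simp del: funpow.simps)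
qed

text \<open>With A = s x and B = y / s, so that A B = x y, the two exponents differ by the square -
  (pi/4) (A + B)^2.\<close>

lemma gaussian_exponent_le:
  fixes s x y :: real
  assumes "s > 0"
  shows "exp (- (3/4) * pi * (s * x - y / s)\<^sup>2) * exp (- 2 * pi * (x * y))
    \<le> exp (- (pi / 2) * ((s * x)\<^sup>2 + (y / s)\<^sup>2))"
proof -
  define A B where "A = s * x" and "B = y / s"
  have xy: "x * y = A * B" using assms by (simp add: A_def B_def)
  have "- (3/4) * pi * (A - B)\<^sup>2 + - 2 * pi * (A * B) = - (pi / 2) * (A\<^sup>2 + B\<^sup>2) - pi / 4 * (A + B)\<^sup>2"
    by (simp add: power2_eq_square field_simps)
  hence "- (3/4) * pi * (A - B)\<^sup>2 + - 2 * pi * (A * B) \<le> - (pi / 2) * (A\<^sup>2 + B\<^sup>2)" by simp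
  thus ?thesis unfolding exp_add[symmetric] xy A_def[symmetric] B_def[symmetric] by simp
qed

text \<open>Subtracting the sign changes only the term k = 0, after which every term carries a
  Gaussian. The dependence on \<open>c\<close> is confined to \<open>L ^ d\<close> and the final
  Gaussian; \<open>K\<close> is uniform.\<close>

lemma p_component_minus_sgn_le:
  "\<exists>K\<ge>0. \<forall>c\<in>C_cone. \<forall>x L. cone_scale c \<le> L \<longrightarrow> 1 / cone_scale c \<le> L \<longrightarrow>
     \<bar>p_component d c \<alpha> \<beta> x - sgn_neg (B1 c x) * (fst x ^ \<alpha> * snd x ^ \<beta>)\<bar> * exp (- 2 * pi * Q1 x)
     \<le> K * L ^ d * (1 + \<bar>fst x\<bar> + \<bar>snd x\<bar>) ^ (\<alpha> + \<beta>) *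
        exp (- (pi / 2) * ((cone_scale c * fst x)\<^sup>2 + (snd x / cone_scale c)\<^sup>2))"
proof -
  define n where "n = \<alpha> + \<beta>"
  have "\<forall>k. \<exists>K\<ge>0. \<forall>c\<in>C_cone. \<forall>x. \<bar>rho c k x - (if k = 0 then sgn_neg (B1 c x) else 0)\<bar>
     \<le> K * exp (- (3/4) * pi * (cone_scale c * fst x - snd x / cone_scale c)\<^sup>2)"
    using rho_minus_sgn_le by blast
  then obtain K where K0: "\<And>k. K k \<ge> 0"
    and K: "\<And>k c x. c \<in> C_cone \<Longrightarrow> \<bar>rho c k x - (if k = 0 then sgn_neg (B1 c x) else 0)\<bar>
     \<le> K k * exp (- (3/4) * pi * (cone_scale c * fst x - snd x / cone_scale c)\<^sup>2)"
    by metis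
  define M where "M = (\<Sum>k\<le>d. K k * real n ^ k)"
  have M: "M \<ge> 0" unfolding M_def by (intro sum_nonneg mult_nonneg_nonneg K0) auto
  have "\<bar>p_component d c \<alpha> \<beta> x - sgn_neg (B1 c x) * (fst x ^ \<alpha> * snd x ^ \<beta>)\<bar> * exp (- 2 * pi * Q1 x)
     \<le> M * L ^ d * (1 + \<bar>fst x\<bar> + \<bar>snd x\<bar>) ^ n *
        exp (- (pi / 2) * ((cone_scale c * fst x)\<^sup>2 + (snd x / cone_scale c)\<^sup>2))"
    if c: "c \<in> C_cone" and L: "cone_scale c \<le> L" "1 / cone_scale c \<le> L" for c x L
  proof -
    define s where "s = cone_scale c"
    define W where "W = (1 + \<bar>fst x\<bar> + \<bar>snd x\<bar>) ^ n"
    define G where "G = exp (- (3/4) * pi * (s * fst x - snd x / s)\<^sup>2)"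
    define r where "r k = rho c k x - (if k = 0 then sgn_neg (B1 c x) else 0)" for k
    have s: "s > 0" using cone_scale_pos[OF c] by (simp add: s_def)
    have L0: "L > 0" using L(1) s by (simp add: s_def)
    \<comment> \<open>One of s and 1 / s is at least 1. This permits replacing \<open>L ^ k\<close>
      by \<open>L ^ d\<close>.\<close>
    have L1: "L \<ge> 1"
    proof (cases "s \<ge> 1")
      case True thus ?thesis using L(1) by (simp add: s_def)
    next
      case False
      hence "1 / s \<ge> 1" using s by simp
      thus ?thesis using L(2) by (simp add: s_def)
    qed
    have W: "W \<ge> 0" by (simp add: W_def)
    have "p_component d c \<alpha> \<beta> x - sgn_neg (B1 c x) * (fst x ^ \<alpha> * snd x ^ \<beta>) =
        (\<Sum>k\<le>d. (- 1 / (4 * pi)) ^ k * (r k / fact k) * cone_mono_del c k \<alpha> \<beta> x)"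
    proof -
      have "p_component d c \<alpha> \<beta> x = (\<Sum>k\<le>d. (- 1 / (4 * pi)) ^ k * (r k / fact k) * cone_mono_del c k \<alpha> \<beta> x
          + (if k = 0 then sgn_neg (B1 c x) * cone_mono_del c 0 \<alpha> \<beta> x else 0))"
        unfolding p_component_def by (intro sum.cong refl) (auto simp: r_def algebra_simps)
      also have "\<dots> = (\<Sum>k\<le>d. (- 1 / (4 * pi)) ^ k * (r k / fact k) * cone_mono_del c k \<alpha> \<beta> x)
          + sgn_neg (B1 c x) * cone_mono_del c 0 \<alpha> \<beta> x"
        by (simp add: sum.distrib)
      also have "cone_mono_del c 0 \<alpha> \<beta> x = fst x ^ \<alpha> * snd x ^ \<beta>"
        by (simp add: cone_mono_del_def)
      finally show ?thesis by simp
    qed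
    also have "\<bar>\<dots>\<bar> \<le> (\<Sum>k\<le>d. K k * G * (L ^ d * real n ^ k * W))"
    proof (rule order_trans[OF sum_abs], rule sum_mono)
      fix k assume k: "k \<in> {..d}"
      have "\<bar>cone_mono_del c k \<alpha> \<beta> x\<bar> \<le> (L * real n) ^ k * W"
        unfolding cone_mono_del_def W_def n_def if_P[OF c]
        using L L0 by (intro mono_del_le) (auto simp: fst_over_sqrt_Q1[OF c] snd_over_sqrt_Q1[OF c] cone_scale_pos[OF c] less_imp_le)
      also have "\<dots> \<le> L ^ d * real n ^ k * W"
        unfolding power_mult_distrib using k L1 W by (intro mult_right_mono power_increasing) auto
      finally have D: "\<bar>cone_mono_del c k \<alpha> \<beta> x\<bar> \<le> L ^ d * real n ^ k * W" .
      have r: "\<bar>r k\<bar> \<le> K k * G"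
        using K[OF c, of k x] by (simp add: r_def G_def s_def)
      have "\<bar>(- 1 / (4 * pi)) ^ k * (r k / fact k) * cone_mono_del c k \<alpha> \<beta> x\<bar> =
          (\<bar>- 1 / (4 * pi)\<bar> ^ k / fact k) * \<bar>r k\<bar> * \<bar>cone_mono_del c k \<alpha> \<beta> x\<bar>"
        by (simp add: abs_mult power_abs)
      also have "\<dots> \<le> 1 * (K k * G) * (L ^ d * real n ^ k * W)"
      proof (intro mult_mono r D)
        have "\<bar>- 1 / (4 * pi)\<bar> \<le> 1" using pi_gt3 by simp
        hence "\<bar>- 1 / (4 * pi)\<bar> ^ k \<le> 1" by (intro power_le_one) auto
        also have "1 \<le> (fact k :: real)" by (rule fact_ge_1)
        finally show "\<bar>- 1 / (4 * pi)\<bar> ^ k / fact k \<le> 1" by simp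
      qed (auto intro!: mult_nonneg_nonneg K0 simp: G_def)
      finally show "\<bar>(- 1 / (4 * pi)) ^ k * (r k / fact k) * cone_mono_del c k \<alpha> \<beta> x\<bar>
          \<le> K k * G * (L ^ d * real n ^ k * W)" by simp
    qed
    also have "\<dots> = M * L ^ d * W * G"
      by (simp add: M_def sum_distrib_left sum_distrib_right mult_ac)
    finally have "\<bar>p_component d c \<alpha> \<beta> x - sgn_neg (B1 c x) * (fst x ^ \<alpha> * snd x ^ \<beta>)\<bar> * exp (- 2 * pi * Q1 x)
        \<le> M * L ^ d * W * G * exp (- 2 * pi * Q1 x)"
      by (intro mult_right_mono) auto
    also have "\<dots> = M * L ^ d * W * (G * exp (- 2 * pi * (fst x * snd x)))"
      by (simp add: Q1_def)
    also have "\<dots> \<le> M * L ^ d * W * exp (- (pi / 2) * ((s * fst x)\<^sup>2 + (snd x / s)\<^sup>2))"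
      unfolding G_def using M L0 W by (intro mult_left_mono gaussian_exponent_le[OF s]) auto
    finally show ?thesis by (simp only: W_def s_def)
  qed
  with M show ?thesis unfolding n_def by blast
qed

text \<open>With p = \<open>- fst c\<close> and r = \<open>snd c\<close>, the signs of r x - p y and
  x - y differ only in the double sector between the lines r x = p y and x = y. As 0 \<le> p \<le>
  r, it lies where x y \<ge> 0 and |x| is between (p/r) |y| and |y|.\<close>

lemma sgn_neg_differ_low:
  assumes "sgn_neg (B1 c x) \<noteq> sgn_neg (fst x - snd x)"
    and "fst c \<le> 0" "0 < snd c" "- fst c \<le> snd c"
  shows "fst x * snd x = \<bar>fst x\<bar> * \<bar>snd x\<bar>" "\<bar>fst x\<bar> \<le> \<bar>snd x\<bar>" "- fst c * \<bar>snd x\<bar> \<le> snd c * \<bar>fst x\<bar>"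
proof -
  define p r u w where "p = - fst c" and "r = snd c" and "u = fst x" and "w = snd x"
  have pr: "0 \<le> p" "0 < r" "p \<le> r" using assms by (auto simp: p_def r_def)
  have B: "B1 c x = r * u - p * w" by (simp add: B1_def p_def r_def u_def w_def)
  consider "r * u > p * w" "u \<le> w" | "r * u \<le> p * w" "w < u"
    using assms(1) unfolding B by (auto simp: sgn_neg_def u_def w_def split: if_splits)
  hence "u * w = \<bar>u\<bar> * \<bar>w\<bar> \<and> \<bar>u\<bar> \<le> \<bar>w\<bar> \<and> p * \<bar>w\<bar> \<le> r * \<bar>u\<bar>"
  proof cases
    case 1
    have "0 < w"
    proof (rule ccontr)
      assume "\<not> 0 < w"
      hence "r * w \<le> p * w" using pr by (intro mult_right_mono_neg) auto
      moreover have "r * u \<le> r * w" using 1 pr by simp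
      ultimately show False using 1 by simp
    qed
    hence "0 < r * u" using 1 pr by (intro le_less_trans[OF mult_nonneg_nonneg 1(1)]) auto
    hence "0 < u" using pr by (simp add: zero_less_mult_iff)
    thus ?thesis using 1 \<open>0 < w\<close> by simp
  next
    case 2
    have "w < 0"
    proof (rule ccontr)
      assume "\<not> w < 0"
      hence "p * w \<le> r * w" using pr by (intro mult_right_mono) auto
      moreover have "r * w < r * u" using 2 pr by simp
      ultimately show False using 2 by simp
    qed
    hence "p * w \<le> 0" using pr by (simp add: mult_nonneg_nonpos)
    hence "r * u \<le> 0" using 2 by simp
    hence "u \<le> 0" using pr by (simp add: mult_le_0_iff)
    thus ?thesis using 2 \<open>w < 0\<close> by simp
  qed
  thus "fst x * snd x = \<bar>fst x\<bar> * \<bar>snd x\<bar>" "\<bar>fst x\<bar> \<le> \<bar>snd x\<bar>" "- fst c * \<bar>snd x\<bar> \<le> snd c * \<bar>fst x\<bar>"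
    by (auto simp: u_def w_def p_def r_def)
qed

text \<open>Reduces to the previous lemma by the symmetry \<open>(x, y) \<mapsto> (- y, - x)\<close>, which preserves \<open>Q1\<close> and
  \<open>x - y\<close> and exchanges the two cusps.\<close>

lemma sgn_neg_differ_high:
  assumes "sgn_neg (B1 c x) \<noteq> sgn_neg (fst x - snd x)"
    and "fst c < 0" "0 \<le> snd c" "snd c \<le> - fst c"
  shows "fst x * snd x = \<bar>fst x\<bar> * \<bar>snd x\<bar>" "\<bar>snd x\<bar> \<le> \<bar>fst x\<bar>" "snd c * \<bar>fst x\<bar> \<le> - fst c * \<bar>snd x\<bar>"
proof -
  have "sgn_neg (B1 c x) = sgn_neg (B1 (- snd c, - fst c) (- snd x, - fst x))"
    by (simp add: B1_def algebra_simps)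
  hence differ: "sgn_neg (B1 (- snd c, - fst c) (- snd x, - fst x)) \<noteq>
      sgn_neg (fst (- snd x, - fst x) - snd (- snd x, - fst x))"
    using assms(1) by simp
  show "fst x * snd x = \<bar>fst x\<bar> * \<bar>snd x\<bar>" "\<bar>snd x\<bar> \<le> \<bar>fst x\<bar>" "snd c * \<bar>fst x\<bar> \<le> - fst c * \<bar>snd x\<bar>"
    using sgn_neg_differ_low[OF differ] assms by (simp_all add: mult.commute)
qed

text \<open>Exchanging one sign for another costs at most twice the monomial, and only where they
  differ; there the weight \<open>e\<close> alone has to provide the decay.\<close>

lemma abs_p_component_minus_reference_le:
  assumes "\<bar>P - s * m\<bar> * e \<le> X" "\<bar>m\<bar> \<le> W" "0 \<le> X" "0 \<le> e" "s \<noteq> s' \<Longrightarrow> W * e \<le> Y" "0 \<le> Y"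
    "\<bar>s\<bar> = 1" "\<bar>s'\<bar> = (1 :: real)"
  shows "\<bar>P - s' * m\<bar> * e \<le> X + 2 * Y"
proof (cases "s = s'")
  case True
  thus ?thesis using assms by simp
next
  case False
  have "\<bar>P - s' * m\<bar> \<le> \<bar>P - s * m\<bar> + \<bar>s - s'\<bar> * \<bar>m\<bar>"
    by (simp add: abs_mult[symmetric] algebra_simps)
  also have "\<bar>s - s'\<bar> * \<bar>m\<bar> \<le> 2 * W"
    using assms by (intro mult_mono) auto
  finally have "\<bar>P - s' * m\<bar> * e \<le> (\<bar>P - s * m\<bar> + 2 * W) * e"
    using assms by (intro mult_right_mono) auto
  also have "\<dots> \<le> X + 2 * Y" using assms(1) assms(5)[OF False] by (simp add: algebra_simps)
  finally show ?thesis .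
qed

lemma monomial_le:
  "\<bar>fst x ^ \<alpha> * snd x ^ \<beta>\<bar> \<le> (1 + \<bar>fst x\<bar> + \<bar>snd x\<bar>) ^ (\<alpha> + \<beta> :: nat)" for x :: "real \<times> real"
  using mono_del_le[of 0 0 0 0 \<alpha> \<beta> x] by simp

lemma abs_sgn_neg: "\<bar>sgn_neg x\<bar> = 1"
  by (simp add: sgn_neg_def)

lemma cone_scale_square: "c \<in> C_cone \<Longrightarrow> snd c = (cone_scale c)\<^sup>2 * - fst c"
  by (auto simp: cone_scale_def C_cone_iff divide_pos_neg less_imp_le)

lemma cone_scale_ge_1_iff: "c \<in> C_cone \<Longrightarrow> 1 \<le> cone_scale c \<longleftrightarrow> - fst c \<le> snd c"
  using pos_le_divide_eq[of "- fst c" 1 "snd c"] by (simp add: cone_scale_def C_cone_iff)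

lemma cone_scale_le_1_iff: "c \<in> C_cone \<Longrightarrow> cone_scale c \<le> 1 \<longleftrightarrow> snd c \<le> - fst c"
  using pos_divide_le_eq[of "- fst c" "snd c" 1] by (simp add: cone_scale_def C_cone_iff)

text \<open>For fixed \<open>c\<close> the Gaussian is nondegenerate and the sector of differing
  signs stays away from the axes, so constants depending on \<open>c\<close> suffice.\<close>

lemma p_component_cone_bound:
  assumes c: "c \<in> C_cone"
  shows "\<exists>K e. 0 < e \<and> (\<forall>x. \<bar>p_component d c \<alpha> \<beta> x - sgn_neg (fst x - snd x) * (fst x ^ \<alpha> * snd x ^ \<beta>)\<bar>
      * exp (- 2 * pi * Q1 x) \<le> K * exp (- e * (\<bar>fst x\<bar> + \<bar>snd x\<bar>)))"
proof -
  define s where "s = cone_scale c"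
  define L where "L = max s (1 / s)"
  define n where "n = \<alpha> + \<beta>"
  \<comment> \<open>As s and 1 / s are at least 1 / L, the Gaussian exponent is at least q (x^2 +
    y^2).\<close>
  define q where "q = pi / (2 * L\<^sup>2)"
  have s: "s > 0" using cone_scale_pos[OF c] by (simp add: s_def)
  have L: "s \<le> L" "1 / s \<le> L" by (auto simp: L_def)
  have L0: "L > 0" using L(1) s by linarith
  have q: "q > 0" using L0 by (simp add: q_def)
  obtain K where K: "K \<ge> 0" and bound:
    "\<And>x. \<bar>p_component d c \<alpha> \<beta> x - sgn_neg (B1 c x) * (fst x ^ \<alpha> * snd x ^ \<beta>)\<bar> * exp (- 2 * pi * Q1 x)
     \<le> K * L ^ d * (1 + \<bar>fst x\<bar> + \<bar>snd x\<bar>) ^ n * exp (- (pi / 2) * ((s * fst x)\<^sup>2 + (snd x / s)\<^sup>2))"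
    using p_component_minus_sgn_le[of d \<alpha> \<beta>] c L unfolding n_def s_def by blast
  obtain N where N: "N \<ge> 0" "\<And>r. r \<ge> 0 \<Longrightarrow> (1 + r) ^ n \<le> N * exp (q * r)"
    using power_le_exp_mult[OF q] by blast
  define E where "E x = N * exp (2 * q) * exp (- q * (\<bar>fst x\<bar> + \<bar>snd x\<bar>))" for x :: "real \<times> real"
  have E0: "E x \<ge> 0" for x using N by (simp add: E_def)
  have decay: "(1 + \<bar>fst x\<bar> + \<bar>snd x\<bar>) ^ n * exp (- (q * ((fst x)\<^sup>2 + (snd x)\<^sup>2))) \<le> E x" for x
  proof -
    define r where "r = \<bar>fst x\<bar> + \<bar>snd x\<bar>"
    \<comment> \<open>The quadratic exponent is traded for a linear one of rate 2 q; half of that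
      rate absorbs the polynomial.\<close>
    have "2 * \<bar>fst x\<bar> \<le> 1 + (fst x)\<^sup>2" "2 * \<bar>snd x\<bar> \<le> 1 + (snd x)\<^sup>2"
      using sum_squares_bound[of 1 "\<bar>fst x\<bar>"] sum_squares_bound[of 1 "\<bar>snd x\<bar>"] by auto
    hence "2 * r - 2 \<le> (fst x)\<^sup>2 + (snd x)\<^sup>2" by (simp add: r_def)
    hence "q * (2 * r - 2) \<le> q * ((fst x)\<^sup>2 + (snd x)\<^sup>2)" using q by (intro mult_left_mono) auto
    hence "exp (- (q * ((fst x)\<^sup>2 + (snd x)\<^sup>2))) \<le> exp (2 * q + - 2 * q * r)" by (simp add: algebra_simps)
    moreover have "(1 + r) ^ n \<le> N * exp (q * r)" using N by (simp add: r_def)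
    ultimately have "(1 + r) ^ n * exp (- (q * ((fst x)\<^sup>2 + (snd x)\<^sup>2))) \<le> N * exp (q * r) * exp (2 * q + - 2 * q * r)"
      using N by (intro mult_mono) auto
    also have "\<dots> = N * (exp (q * r) * exp (2 * q + - 2 * q * r))" by simp
    also have "exp (q * r) * exp (2 * q + - 2 * q * r) = exp (2 * q) * exp (- q * r)"
      by (simp flip: exp_add)
    finally show ?thesis by (simp add: r_def E_def add.assoc)
  qed
  have gauss: "exp (- (pi / 2) * ((s * fst x)\<^sup>2 + (snd x / s)\<^sup>2)) \<le> exp (- (q * ((fst x)\<^sup>2 + (snd x)\<^sup>2)))"
    for x :: "real \<times> real"
  proof -
    have "1 / L \<le> s" "1 / L \<le> 1 / s" using L s L0 by (simp_all add: field_simps)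
    hence "(1 / L)\<^sup>2 \<le> s\<^sup>2" "(1 / L)\<^sup>2 \<le> (1 / s)\<^sup>2" using L0 by (intro power_mono; simp)+
    hence "(1 / L)\<^sup>2 * (fst x)\<^sup>2 + (1 / L)\<^sup>2 * (snd x)\<^sup>2 \<le> s\<^sup>2 * (fst x)\<^sup>2 + (1 / s)\<^sup>2 * (snd x)\<^sup>2"
      by (intro add_mono mult_right_mono) auto
    hence "(pi / 2) * ((1 / L)\<^sup>2 * (fst x)\<^sup>2 + (1 / L)\<^sup>2 * (snd x)\<^sup>2)
        \<le> (pi / 2) * (s\<^sup>2 * (fst x)\<^sup>2 + (1 / s)\<^sup>2 * (snd x)\<^sup>2)"
      by (intro mult_left_mono) auto
    thus ?thesis by (simp add: q_def power_mult_distrib power_divide algebra_simps)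
  qed
  have differ: "(1 + \<bar>fst x\<bar> + \<bar>snd x\<bar>) ^ n * exp (- 2 * pi * Q1 x) \<le> E x"
    if ne: "sgn_neg (B1 c x) \<noteq> sgn_neg (fst x - snd x)" for x
  proof -
    have L2: "s\<^sup>2 \<le> L\<^sup>2" "1 \<le> L\<^sup>2 * s\<^sup>2"
    proof -
      show "s\<^sup>2 \<le> L\<^sup>2" using L s by (intro power_mono) auto
      have "1 \<le> L * s" using L s by (simp add: field_simps)
      hence "1\<^sup>2 \<le> (L * s)\<^sup>2" by (intro power_mono) auto
      thus "1 \<le> L\<^sup>2 * s\<^sup>2" by (simp add: power_mult_distrib)
    qed
    \<comment> \<open>In the sector the two coordinates agree up to a factor L^2, so their product
      controls both squares.\<close>
    have sq: "a\<^sup>2 + b\<^sup>2 \<le> 2 * L\<^sup>2 * (a * b)" if "0 \<le> a" "a \<le> b" "b \<le> L\<^sup>2 * a" for a b :: real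
    proof -
      have "a\<^sup>2 \<le> b\<^sup>2" using that by (intro power_mono) auto
      moreover have "b * b \<le> L\<^sup>2 * a * b" using that by (intro mult_right_mono) auto
      ultimately show ?thesis by (simp add: power2_eq_square algebra_simps)
    qed
    have fs: "fst c < 0" "0 < snd c" using c by (auto simp: C_cone_iff)
    have "(fst x)\<^sup>2 + (snd x)\<^sup>2 \<le> 2 * L\<^sup>2 * Q1 x"
    proof (cases "- fst c \<le> snd c")
      case True
      note d = sgn_neg_differ_low[OF ne less_imp_le[OF fs(1)] fs(2) True]
      have "- fst c * \<bar>snd x\<bar> \<le> - fst c * (s\<^sup>2 * \<bar>fst x\<bar>)"
        using d(3) cone_scale_square[OF c] by (simp add: s_def mult_ac)
      hence "\<bar>snd x\<bar> \<le> s\<^sup>2 * \<bar>fst x\<bar>" using fs by simp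
      also have "\<dots> \<le> L\<^sup>2 * \<bar>fst x\<bar>" using L2 by (intro mult_right_mono) auto
      finally show ?thesis using sq[of "\<bar>fst x\<bar>" "\<bar>snd x\<bar>"] d by (simp add: Q1_def)
    next
      case False
      note d = sgn_neg_differ_high[OF ne fs(1) less_imp_le[OF fs(2)]]
      have "- fst c * (s\<^sup>2 * \<bar>fst x\<bar>) \<le> - fst c * \<bar>snd x\<bar>"
        using d(3) False cone_scale_square[OF c] by (simp add: s_def mult_ac)
      hence *: "s\<^sup>2 * \<bar>fst x\<bar> \<le> \<bar>snd x\<bar>" using fs by simp
      have "1 * \<bar>fst x\<bar> \<le> (L\<^sup>2 * s\<^sup>2) * \<bar>fst x\<bar>" using L2 by (intro mult_right_mono) auto
      also have "\<dots> \<le> L\<^sup>2 * \<bar>snd x\<bar>" unfolding mult.assoc using * by (intro mult_left_mono) auto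
      finally show ?thesis using sq[of "\<bar>snd x\<bar>" "\<bar>fst x\<bar>"] d False
        by (simp add: Q1_def mult.commute add.commute)
    qed
    hence "q * ((fst x)\<^sup>2 + (snd x)\<^sup>2) \<le> q * (2 * L\<^sup>2 * Q1 x)" using q by (intro mult_left_mono) auto
    also have "\<dots> = pi * Q1 x" using L0 by (simp add: q_def)
    also have "\<dots> \<le> 2 * pi * Q1 x"
    proof -
      have "0 \<le> 2 * L\<^sup>2 * Q1 x"
        using \<open>(fst x)\<^sup>2 + (snd x)\<^sup>2 \<le> 2 * L\<^sup>2 * Q1 x\<close> by (smt (verit) zero_le_power2)
      hence "0 \<le> Q1 x" using L0 by (simp add: zero_le_mult_iff)
      thus ?thesis by simp
    qed
    finally have "exp (- 2 * pi * Q1 x) \<le> exp (- (q * ((fst x)\<^sup>2 + (snd x)\<^sup>2)))" by simp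
    hence "(1 + \<bar>fst x\<bar> + \<bar>snd x\<bar>) ^ n * exp (- 2 * pi * Q1 x)
        \<le> (1 + \<bar>fst x\<bar> + \<bar>snd x\<bar>) ^ n * exp (- (q * ((fst x)\<^sup>2 + (snd x)\<^sup>2)))"
      by (intro mult_left_mono) auto
    thus ?thesis using decay[of x] by linarith
  qed
  have "\<bar>p_component d c \<alpha> \<beta> x - sgn_neg (fst x - snd x) * (fst x ^ \<alpha> * snd x ^ \<beta>)\<bar> * exp (- 2 * pi * Q1 x)
      \<le> K * L ^ d * E x + 2 * E x" for x
  proof (rule abs_p_component_minus_reference_le[where W = "(1 + \<bar>fst x\<bar> + \<bar>snd x\<bar>) ^ n"])
    have "K * L ^ d * (1 + \<bar>fst x\<bar> + \<bar>snd x\<bar>) ^ n * exp (- (pi / 2) * ((s * fst x)\<^sup>2 + (snd x / s)\<^sup>2))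
       \<le> K * L ^ d * ((1 + \<bar>fst x\<bar> + \<bar>snd x\<bar>) ^ n * exp (- (q * ((fst x)\<^sup>2 + (snd x)\<^sup>2))))"
      unfolding mult.assoc using K L0 gauss by (intro mult_left_mono) auto
    also have "\<dots> \<le> K * L ^ d * E x" using K L0 by (intro mult_left_mono decay) auto
    finally show "\<bar>p_component d c \<alpha> \<beta> x - sgn_neg (B1 c x) * (fst x ^ \<alpha> * snd x ^ \<beta>)\<bar> * exp (- 2 * pi * Q1 x)
        \<le> K * L ^ d * E x" using bound[of x] by linarith
  qed (use monomial_le differ E0 K L0 in \<open>auto simp: n_def abs_sgn_neg\<close>)
  moreover have "K * L ^ d * E x + 2 * E x =
      ((K * L ^ d + 2) * (N * exp (2 * q))) * exp (- q * (\<bar>fst x\<bar> + \<bar>snd x\<bar>))" for x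
    by (simp add: E_def algebra_simps)
  ultimately show ?thesis using q by metis
qed

text \<open>Uniformly in \<open>L\<close>: half of the Gaussian is spent on \<open>(L x)\<^sup>2 + (y / L)\<^sup>2 \<ge> 2 |x y| \<ge> 2 \<delta> |y|\<close>, the
  rest on \<open>(L x)\<^sup>2\<close>, which dominates both \<open>\<delta> |x|\<close> and \<open>\<delta>\<^sup>2 L\<close> and so absorbs the powers of \<open>L\<close>.\<close>

lemma near_cusp_gaussian_le:
  fixes \<delta> :: real
  assumes "\<delta> > 0"
  shows "\<exists>K\<ge>0. \<forall>L\<ge>1. \<forall>x y. \<delta> \<le> \<bar>x\<bar> \<longrightarrow>
    L ^ k * ((1 + \<bar>x\<bar> + \<bar>y\<bar>) ^ n * exp (- (pi / 2) * ((L * x)\<^sup>2 + (y / L)\<^sup>2)))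
    \<le> K * exp (- (pi * \<delta> / 16) * (\<bar>x\<bar> + \<bar>y\<bar>))"
proof -
  obtain N where N: "N \<ge> 0" "\<And>r. r \<ge> 0 \<Longrightarrow> (1 + r) ^ n \<le> N * exp (pi * \<delta> / 16 * r)"
    using power_le_exp_mult[of "pi * \<delta> / 16"] assms by auto
  obtain M where M: "M \<ge> 0" "\<And>r. r \<ge> 0 \<Longrightarrow> (1 + r) ^ k \<le> M * exp (pi * \<delta>\<^sup>2 / 8 * r)"
    using power_le_exp_mult[of "pi * \<delta>\<^sup>2 / 8"] assms by auto
  have "L ^ k * ((1 + \<bar>x\<bar> + \<bar>y\<bar>) ^ n * exp (- (pi / 2) * ((L * x)\<^sup>2 + (y / L)\<^sup>2)))
    \<le> M * N * exp (- (pi * \<delta> / 16) * (\<bar>x\<bar> + \<bar>y\<bar>))" if L: "L \<ge> 1" and x: "\<delta> \<le> \<bar>x\<bar>" for L x y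
  proof -
    define A B r where "A = L * \<bar>x\<bar>" and "B = \<bar>y\<bar> / L" and "r = \<bar>x\<bar> + \<bar>y\<bar>"
    have sq: "(L * x)\<^sup>2 = A\<^sup>2" "(y / L)\<^sup>2 = B\<^sup>2"
      by (auto simp: A_def B_def power_mult_distrib power_divide)
    have AB: "A * B = \<bar>x\<bar> * \<bar>y\<bar>" using L by (simp add: A_def B_def)
    have "\<delta> * \<bar>y\<bar> \<le> \<bar>x\<bar> * \<bar>y\<bar>" using x by (intro mult_right_mono) auto
    moreover have "2 * (\<bar>x\<bar> * \<bar>y\<bar>) \<le> A\<^sup>2 + B\<^sup>2"
      unfolding AB[symmetric] using sum_squares_bound[of A B] by simp
    moreover have "L * \<delta>\<^sup>2 \<le> A\<^sup>2"
    proof -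
      have "L * \<delta>\<^sup>2 \<le> L\<^sup>2 * \<bar>x\<bar>\<^sup>2"
        using L x assms by (intro mult_mono power_mono self_le_power) auto
      thus ?thesis by (simp add: A_def power_mult_distrib)
    qed
    moreover have "\<delta> * \<bar>x\<bar> \<le> A\<^sup>2"
    proof -
      have "\<delta> * \<bar>x\<bar> \<le> \<bar>x\<bar> * \<bar>x\<bar>" using x by (intro mult_right_mono) auto
      also have "\<dots> = 1 * \<bar>x\<bar>\<^sup>2" by (simp add: power2_eq_square)
      also have "\<dots> \<le> L\<^sup>2 * \<bar>x\<bar>\<^sup>2" using L by (intro mult_right_mono) auto
      finally show ?thesis by (simp add: A_def power_mult_distrib)
    qed
    moreover have "0 \<le> \<delta> * \<bar>y\<bar>" "0 \<le> A\<^sup>2" "0 \<le> B\<^sup>2" using assms by auto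
    \<comment> \<open>Fresh variables turn the combination of the estimates into linear arithmetic;
      the factor 1/8 is generous.\<close>
    moreover have "(u + w + p) / 8 \<le> (a + b) / 2"
      if "p \<le> q" "2 * q \<le> a + b" "u \<le> a" "w \<le> a" "0 \<le> p" "0 \<le> a" "0 \<le> b" for a b p q u w :: real
      using that by (simp add: field_simps)
    ultimately have "(L * \<delta>\<^sup>2 + \<delta> * \<bar>x\<bar> + \<delta> * \<bar>y\<bar>) / 8 \<le> (A\<^sup>2 + B\<^sup>2) / 2" by blast
    hence "pi * ((L * \<delta>\<^sup>2 + \<delta> * \<bar>x\<bar> + \<delta> * \<bar>y\<bar>) / 8) \<le> pi * ((A\<^sup>2 + B\<^sup>2) / 2)"
      by (intro mult_left_mono) auto
    moreover have "pi * ((A\<^sup>2 + B\<^sup>2) / 2) = - (- (pi / 2) * (A\<^sup>2 + B\<^sup>2))"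
      "pi * ((L * \<delta>\<^sup>2 + \<delta> * \<bar>x\<bar> + \<delta> * \<bar>y\<bar>) / 8) = - (- (pi * \<delta>\<^sup>2 / 8 * L) + - (pi * \<delta> / 8 * r))"
      by (simp_all add: r_def field_simps)
    ultimately have ex: "exp (- (pi / 2) * (A\<^sup>2 + B\<^sup>2)) \<le> exp (- (pi * \<delta>\<^sup>2 / 8 * L) + - (pi * \<delta> / 8 * r))"
      by (simp only: exp_le_cancel_iff neg_le_iff_le)
    have "L ^ k \<le> (1 + L) ^ k" using L by (intro power_mono) auto
    also have "\<dots> \<le> M * exp (pi * \<delta>\<^sup>2 / 8 * L)" using M L by auto
    finally have Lk: "L ^ k \<le> M * exp (pi * \<delta>\<^sup>2 / 8 * L)" .
    have Wn: "(1 + \<bar>x\<bar> + \<bar>y\<bar>) ^ n \<le> N * exp (pi * \<delta> / 16 * r)"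
      using N(2)[of r] by (simp add: r_def add.assoc)
    have "L ^ k * ((1 + \<bar>x\<bar> + \<bar>y\<bar>) ^ n * exp (- (pi / 2) * (A\<^sup>2 + B\<^sup>2))) \<le>
        (M * exp (pi * \<delta>\<^sup>2 / 8 * L)) * ((N * exp (pi * \<delta> / 16 * r)) * exp (- (pi * \<delta>\<^sup>2 / 8 * L) + - (pi * \<delta> / 8 * r)))"
      using L M N by (intro mult_mono Lk Wn ex) auto
    also have "\<dots> = M * N * (exp (pi * \<delta>\<^sup>2 / 8 * L) * exp (pi * \<delta> / 16 * r) * exp (- (pi * \<delta>\<^sup>2 / 8 * L) + - (pi * \<delta> / 8 * r)))"
      by (simp only: mult_ac)
    also have "exp (pi * \<delta>\<^sup>2 / 8 * L) * exp (pi * \<delta> / 16 * r) * exp (- (pi * \<delta>\<^sup>2 / 8 * L) + - (pi * \<delta> / 8 * r))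
        = exp (- (pi * \<delta> / 16) * r)"
      unfolding exp_add[symmetric] by (simp add: algebra_simps)
    finally show ?thesis unfolding sq r_def .
  qed
  thus ?thesis using M(1) N(1) by (intro exI[of _ "M * N"]) auto
qed

text \<open>\<open>L\<close> is whichever of s and 1 / s grows at the cusp. The factor 1 / L of the
  first estimate yields pointwise convergence, the second estimate is the majorant uniform in
  \<open>c\<close>.\<close>

lemma p_component_near_cusp_bound:
  fixes \<delta> :: real
  assumes \<delta>: "\<delta> > 0"
  shows "\<exists>K. \<forall>c\<in>C_cone. \<forall>x L. 1 \<le> L \<longrightarrow>
     (L = cone_scale c \<and> \<delta> \<le> \<bar>fst x\<bar>) \<or> (L = 1 / cone_scale c \<and> \<delta> \<le> \<bar>snd x\<bar>) \<longrightarrow>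
     \<bar>p_component d c \<alpha> \<beta> x - sgn_neg (B1 c x) * (fst x ^ \<alpha> * snd x ^ \<beta>)\<bar> * exp (- 2 * pi * Q1 x) \<le> K * (1 / L) \<and>
     \<bar>p_component d c \<alpha> \<beta> x - sgn_neg (fst x - snd x) * (fst x ^ \<alpha> * snd x ^ \<beta>)\<bar> * exp (- 2 * pi * Q1 x)
       \<le> K * exp (- (pi * \<delta> / 16) * (\<bar>fst x\<bar> + \<bar>snd x\<bar>))"
proof -
  define n where "n = \<alpha> + \<beta>"
  obtain K where K: "K \<ge> 0" and bound:
    "\<And>c x L. c \<in> C_cone \<Longrightarrow> cone_scale c \<le> L \<Longrightarrow> 1 / cone_scale c \<le> L \<Longrightarrow>
      \<bar>p_component d c \<alpha> \<beta> x - sgn_neg (B1 c x) * (fst x ^ \<alpha> * snd x ^ \<beta>)\<bar> * exp (- 2 * pi * Q1 x)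
     \<le> K * L ^ d * (1 + \<bar>fst x\<bar> + \<bar>snd x\<bar>) ^ n *
        exp (- (pi / 2) * ((cone_scale c * fst x)\<^sup>2 + (snd x / cone_scale c)\<^sup>2))"
    using p_component_minus_sgn_le[of d \<alpha> \<beta>] unfolding n_def by blast
  \<comment> \<open>\<open>Suc d\<close> is one power of \<open>L\<close> more than the derivatives
    require; the spare one becomes the factor 1 / L.\<close>
  obtain M where M: "M \<ge> 0" and gauss: "\<And>L x y. L \<ge> 1 \<Longrightarrow> \<delta> \<le> \<bar>x\<bar> \<Longrightarrow>
    L ^ Suc d * ((1 + \<bar>x\<bar> + \<bar>y\<bar>) ^ n * exp (- (pi / 2) * ((L * x)\<^sup>2 + (y / L)\<^sup>2)))
    \<le> M * exp (- (pi * \<delta> / 16) * (\<bar>x\<bar> + \<bar>y\<bar>))"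
    using near_cusp_gaussian_le[OF \<delta>, of "Suc d" n] by blast
  obtain N where N: "N \<ge> 0" "\<And>r. r \<ge> 0 \<Longrightarrow> (1 + r) ^ n \<le> N * exp (pi * \<delta> / 2 * r)"
    using power_le_exp_mult[of "pi * \<delta> / 2"] \<delta> by auto
  have main: "\<bar>p_component d c \<alpha> \<beta> x - sgn_neg (B1 c x) * (fst x ^ \<alpha> * snd x ^ \<beta>)\<bar> * exp (- 2 * pi * Q1 x) \<le> (K * M + 2 * N) * (1 / L) \<and>
     \<bar>p_component d c \<alpha> \<beta> x - sgn_neg (fst x - snd x) * (fst x ^ \<alpha> * snd x ^ \<beta>)\<bar> * exp (- 2 * pi * Q1 x)
       \<le> (K * M + 2 * N) * exp (- (pi * \<delta> / 16) * (\<bar>fst x\<bar> + \<bar>snd x\<bar>))"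
    if c: "c \<in> C_cone" and L: "1 \<le> L"
      and cusp: "(L = cone_scale c \<and> \<delta> \<le> \<bar>fst x\<bar>) \<or> (L = 1 / cone_scale c \<and> \<delta> \<le> \<bar>snd x\<bar>)" for c x L
  proof -
    define s where "s = cone_scale c"
    define r where "r = \<bar>fst x\<bar> + \<bar>snd x\<bar>"
    define g where "g = (1 + \<bar>fst x\<bar> + \<bar>snd x\<bar>) ^ n * exp (- (pi / 2) * ((s * fst x)\<^sup>2 + (snd x / s)\<^sup>2))"
    define e where "e = exp (- (pi * \<delta> / 16) * r)"
    have s: "s > 0" using cone_scale_pos[OF c] by (simp add: s_def)
    have sL: "s \<le> L" "1 / s \<le> L"
    proof -
      have "L = s \<or> L = 1 / s" using cusp by (auto simp: s_def)
      moreover have "1 / s \<le> 1" if "1 \<le> s" using that by simp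
      moreover have "s \<le> 1" if "1 \<le> 1 / s" using that s by simp
      ultimately show "s \<le> L" "1 / s \<le> L" using L by (metis order.trans order.refl)+
    qed
    have e1: "e \<le> 1" using \<delta> by (simp add: e_def r_def)
    have g0: "g \<ge> 0" by (simp add: g_def)
    have "L ^ Suc d * g \<le> M * e"
      using cusp
    proof
      assume "L = cone_scale c \<and> \<delta> \<le> \<bar>fst x\<bar>"
      thus ?thesis using gauss[of L "fst x" "snd x"] L by (simp add: g_def e_def r_def s_def)
    next
      assume *: "L = 1 / cone_scale c \<and> \<delta> \<le> \<bar>snd x\<bar>"
      \<comment> \<open>Exchanging the coordinates reduces the second cusp to the first.\<close>
      hence "L * snd x = snd x / s" "fst x / L = s * fst x" by (auto simp: s_def)
      moreover have "L ^ Suc d * ((1 + \<bar>snd x\<bar> + \<bar>fst x\<bar>) ^ n * exp (- (pi / 2) * ((L * snd x)\<^sup>2 + (fst x / L)\<^sup>2)))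
          \<le> M * exp (- (pi * \<delta> / 16) * (\<bar>snd x\<bar> + \<bar>fst x\<bar>))"
        using gauss L * by blast
      ultimately show ?thesis
        unfolding g_def e_def r_def by (simp only: add_ac)
    qed
    hence gL: "L ^ d * g \<le> M * e * (1 / L)" using L by (simp add: field_simps)
    have bd: "\<bar>p_component d c \<alpha> \<beta> x - sgn_neg (B1 c x) * (fst x ^ \<alpha> * snd x ^ \<beta>)\<bar> * exp (- 2 * pi * Q1 x)
        \<le> K * (M * e * (1 / L))"
    proof -
      have "K * L ^ d * (1 + \<bar>fst x\<bar> + \<bar>snd x\<bar>) ^ n *
        exp (- (pi / 2) * ((cone_scale c * fst x)\<^sup>2 + (snd x / cone_scale c)\<^sup>2)) = K * (L ^ d * g)"
        by (simp add: g_def s_def mult.assoc)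
      also have "\<dots> \<le> K * (M * e * (1 / L))" using K by (intro mult_left_mono gL)
      finally show ?thesis using bound[OF c sL[unfolded s_def], of x] by linarith
    qed
    have "K * (M * e * (1 / L)) \<le> K * (M * 1 * (1 / L))"
      using K M L by (intro mult_left_mono mult_right_mono e1) auto
    also have "\<dots> \<le> (K * M + 2 * N) * (1 / L)" using N L by (simp add: divide_right_mono)
    finally have 1: "K * (M * e * (1 / L)) \<le> (K * M + 2 * N) * (1 / L)" .
    have fs: "fst c < 0" "0 < snd c" using c by (auto simp: C_cone_iff)
    have 2: "\<bar>p_component d c \<alpha> \<beta> x - sgn_neg (fst x - snd x) * (fst x ^ \<alpha> * snd x ^ \<beta>)\<bar> * exp (- 2 * pi * Q1 x)
       \<le> K * (M * e) + 2 * (N * e)"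
    proof (rule abs_p_component_minus_reference_le[where W = "(1 + \<bar>fst x\<bar> + \<bar>snd x\<bar>) ^ n"])
      have "M * e * (1 / L) \<le> M * e * 1" using M L by (intro mult_left_mono) (auto simp: e_def)
      hence "K * (M * e * (1 / L)) \<le> K * (M * e)" using K by (intro mult_left_mono) simp_all
      thus "\<bar>p_component d c \<alpha> \<beta> x - sgn_neg (B1 c x) * (fst x ^ \<alpha> * snd x ^ \<beta>)\<bar> * exp (- 2 * pi * Q1 x)
        \<le> K * (M * e)" using bd by linarith
      show "(1 + \<bar>fst x\<bar> + \<bar>snd x\<bar>) ^ n * exp (- 2 * pi * Q1 x) \<le> N * e"
        if ne: "sgn_neg (B1 c x) \<noteq> sgn_neg (fst x - snd x)"
      proof -
        \<comment> \<open>In the sector of differing signs the coordinate bounded below by \<delta>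
          is the smaller one in absolute value, so x y dominates \<delta> times the larger
          one.\<close>
        have "\<delta> * r \<le> 2 * Q1 x"
          using cusp
        proof
          assume *: "L = cone_scale c \<and> \<delta> \<le> \<bar>fst x\<bar>"
          hence "- fst c \<le> snd c" using L cone_scale_ge_1_iff[OF c] by simp
          note d = sgn_neg_differ_low[OF ne less_imp_le[OF fs(1)] fs(2) this]
          have "\<delta> * \<bar>snd x\<bar> \<le> \<bar>fst x\<bar> * \<bar>snd x\<bar>" using * by (intro mult_right_mono) auto
          moreover have "\<delta> * \<bar>fst x\<bar> \<le> \<delta> * \<bar>snd x\<bar>" using d \<delta> by (intro mult_left_mono) auto
          ultimately show ?thesis using d(1) by (simp add: Q1_def r_def algebra_simps)
        next
          assume *: "L = 1 / cone_scale c \<and> \<delta> \<le> \<bar>snd x\<bar>"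
          hence "cone_scale c \<le> 1" using L s by (simp add: s_def)
          hence "snd c \<le> - fst c" using cone_scale_le_1_iff[OF c] by simp
          note d = sgn_neg_differ_high[OF ne fs(1) less_imp_le[OF fs(2)] this]
          have "\<bar>fst x\<bar> * \<delta> \<le> \<bar>fst x\<bar> * \<bar>snd x\<bar>" using * by (intro mult_left_mono) auto
          moreover have "\<delta> * \<bar>snd x\<bar> \<le> \<delta> * \<bar>fst x\<bar>" using d \<delta> by (intro mult_left_mono) auto
          ultimately show ?thesis using d(1) by (simp add: Q1_def r_def algebra_simps)
        qed
        hence "pi * (\<delta> * r) \<le> pi * (2 * Q1 x)" by (intro mult_left_mono) auto
        hence "exp (- 2 * pi * Q1 x) \<le> exp (- (pi * \<delta> * r))" by (simp add: mult_ac)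
        moreover have "(1 + \<bar>fst x\<bar> + \<bar>snd x\<bar>) ^ n \<le> N * exp (pi * \<delta> / 2 * r)"
          using N(2)[of r] by (simp add: r_def add.assoc)
        ultimately have "(1 + \<bar>fst x\<bar> + \<bar>snd x\<bar>) ^ n * exp (- 2 * pi * Q1 x)
            \<le> (N * exp (pi * \<delta> / 2 * r)) * exp (- (pi * \<delta> * r))"
          using N by (intro mult_mono) auto
        also have "\<dots> = N * exp (- (pi * \<delta> / 2 * r))" by (simp flip: exp_add)
        also have "\<dots> \<le> N * e"
          using N \<delta> unfolding e_def by (intro mult_left_mono) (auto simp: r_def)
        finally show ?thesis .
      qed
    qed (use monomial_le K M N in \<open>auto simp: n_def abs_sgn_neg e_def\<close>)
    show ?thesis
      using bd 1 2 by (simp add: e_def r_def algebra_simps)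
  qed
  thus ?thesis by blast
qed

section \<open>Approaching a cusp from inside the cone\<close>

lemma S_cusps_eq: "S_cusps = {(0, 1), (- 1, 0)}"
proof -
  \<comment> \<open>Vanishing of the form kills one entry, coprimality makes the other 1 or - 1, and
    the order fixes its sign.\<close>
  have "gcd c1 c2 = 1 \<and> Q1 (of_int c1, of_int c2) = 0 \<and> c1 < c2 \<longleftrightarrow>
      (c1 = 0 \<and> c2 = 1) \<or> (c1 = - 1 \<and> c2 = 0)" for c1 c2 :: int
    by (auto simp: Q1_def)
  thus ?thesis unfolding S_cusps_def by auto
qed

lemma not_C_cone_cusp: "c \<in> S_cusps \<Longrightarrow> c \<notin> C_cone"
  by (auto simp: S_cusps_eq C_cone_iff)

lemma p_component_cusp:
  assumes "c \<in> S_cusps"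
  shows "p_component d c \<alpha> \<beta> x = sgn_neg (B1 c x) * (fst x ^ \<alpha> * snd x ^ \<beta>)"
proof -
  have "p_component d c \<alpha> \<beta> x = (\<Sum>k\<le>d. if k = 0 then sgn_neg (B1 c x) * (fst x ^ \<alpha> * snd x ^ \<beta>) else 0)"
    unfolding p_component_def
    by (intro sum.cong refl) (auto simp: rho_def cone_mono_del_def not_C_cone_cusp[OF assms])
  thus ?thesis by simp
qed

lemma cusp_deform_in_C_cone:
  assumes "c \<in> S_cusps" "c' \<in> C_cone" "t > 0"
  shows "c + t *\<^sub>R c' \<in> C_cone"
proof -
  have "t * fst c' < 0" "t * snd c' > 0" using assms by (auto simp: C_cone_iff mult_pos_neg)
  thus ?thesis using assms(1) by (auto simp: S_cusps_eq C_cone_iff)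
qed

text \<open>The squared scale is the ratio of \<open>snd\<close> to minus \<open>fst\<close>; the
  entry that vanishes at the cusp becomes a multiple of t, the other tends to 1 in absolute
  value.\<close>

lemma cone_scale_deform_tendsto:
  assumes "c' \<in> C_cone"
  shows "((\<lambda>t. 1 / cone_scale ((0, 1) + t *\<^sub>R c')) \<longlongrightarrow> 0) (at_right 0)"
    and "((\<lambda>t. cone_scale ((- 1, 0) + t *\<^sub>R c')) \<longlongrightarrow> 0) (at_right 0)"
proof -
  have "((\<lambda>t. sqrt (t * - fst c' / (1 + t * snd c'))) \<longlongrightarrow> sqrt (0 * - fst c' / (1 + 0 * snd c'))) (at_right 0)"
    by (intro tendsto_intros) auto
  moreover have "1 / cone_scale ((0, 1) + t *\<^sub>R c') = sqrt (t * - fst c' / (1 + t * snd c'))" for t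
  proof -
    have "1 / cone_scale ((0, 1) + t *\<^sub>R c') = sqrt (1 / ((1 + t * snd c') / - (t * fst c')))"
      unfolding real_sqrt_divide[of 1] by (simp add: cone_scale_def)
    thus ?thesis by simp
  qed
  ultimately show "((\<lambda>t. 1 / cone_scale ((0, 1) + t *\<^sub>R c')) \<longlongrightarrow> 0) (at_right 0)" by simp
  have "((\<lambda>t. sqrt (t * snd c' / - (- 1 + t * fst c'))) \<longlongrightarrow> sqrt (0 * snd c' / - (- 1 + 0 * fst c'))) (at_right 0)"
    by (intro tendsto_intros) auto
  thus "((\<lambda>t. cone_scale ((- 1, 0) + t *\<^sub>R c')) \<longlongrightarrow> 0) (at_right 0)"
    by (simp add: cone_scale_def)
qed

text \<open>Since |B1 c x| is |x| at (0, 1) and |y| at (- 1, 0), the condition on \<delta> keeps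
  exactly the coordinate away from 0 that the near-cusp bound requires.\<close>

lemma p_component_deform_cusp:
  fixes \<delta> :: real
  assumes c: "c \<in> S_cusps" and c': "c' \<in> C_cone" and \<delta>: "\<delta> > 0"
  shows "\<exists>K e. 0 < e \<and> (\<forall>\<^sub>F t in at_right 0. \<forall>x. \<delta> \<le> \<bar>B1 c x\<bar> \<longrightarrow>
      \<bar>p_component d (c + t *\<^sub>R c') \<alpha> \<beta> x - sgn_neg (fst x - snd x) * (fst x ^ \<alpha> * snd x ^ \<beta>)\<bar>
      * exp (- 2 * pi * Q1 x) \<le> K * exp (- e * (\<bar>fst x\<bar> + \<bar>snd x\<bar>)))"
    and "\<delta> \<le> \<bar>B1 c x\<bar> \<Longrightarrow>
      ((\<lambda>t. p_component d (c + t *\<^sub>R c') \<alpha> \<beta> x) \<longlongrightarrow> p_component d c \<alpha> \<beta> x) (at_right 0)"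
proof -
  define L where "L t = (if c = (0, 1) then cone_scale (c + t *\<^sub>R c') else 1 / cone_scale (c + t *\<^sub>R c'))" for t
  obtain K where K: "\<And>c x L. c \<in> C_cone \<Longrightarrow> 1 \<le> L \<Longrightarrow>
     (L = cone_scale c \<and> \<delta> \<le> \<bar>fst x\<bar>) \<or> (L = 1 / cone_scale c \<and> \<delta> \<le> \<bar>snd x\<bar>) \<Longrightarrow>
     \<bar>p_component d c \<alpha> \<beta> x - sgn_neg (B1 c x) * (fst x ^ \<alpha> * snd x ^ \<beta>)\<bar> * exp (- 2 * pi * Q1 x) \<le> K * (1 / L) \<and>
     \<bar>p_component d c \<alpha> \<beta> x - sgn_neg (fst x - snd x) * (fst x ^ \<alpha> * snd x ^ \<beta>)\<bar> * exp (- 2 * pi * Q1 x)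
       \<le> K * exp (- (pi * \<delta> / 16) * (\<bar>fst x\<bar> + \<bar>snd x\<bar>))"
    using p_component_near_cusp_bound[OF \<delta>, of d \<alpha> \<beta>] by blast
  have L_lim: "((\<lambda>t. 1 / L t) \<longlongrightarrow> 0) (at_right 0)"
    using c cone_scale_deform_tendsto[OF c'] by (auto simp: L_def S_cusps_eq)
  have L_ge: "eventually (\<lambda>t. 1 \<le> L t) (at_right 0)"
    using order_tendstoD(2)[OF L_lim zero_less_one] eventually_at_right_less[of 0]
  proof eventually_elim
    case (elim t)
    have "L t > 0" using cone_scale_pos[OF cusp_deform_in_C_cone[OF c c' elim(2)]] by (auto simp: L_def)
    thus ?case using elim by (simp add: field_simps)
  qed
  have ev: "eventually (\<lambda>t. \<forall>x. \<delta> \<le> \<bar>B1 c x\<bar> \<longrightarrow>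
     \<bar>p_component d (c + t *\<^sub>R c') \<alpha> \<beta> x - sgn_neg (B1 (c + t *\<^sub>R c') x) * (fst x ^ \<alpha> * snd x ^ \<beta>)\<bar> * exp (- 2 * pi * Q1 x)
       \<le> K * (1 / L t) \<and>
     \<bar>p_component d (c + t *\<^sub>R c') \<alpha> \<beta> x - sgn_neg (fst x - snd x) * (fst x ^ \<alpha> * snd x ^ \<beta>)\<bar> * exp (- 2 * pi * Q1 x)
       \<le> K * exp (- (pi * \<delta> / 16) * (\<bar>fst x\<bar> + \<bar>snd x\<bar>))) (at_right 0)"
    using L_ge eventually_at_right_less[of 0]
  proof eventually_elim
    case (elim t)
    show ?case
    proof (intro allI impI K cusp_deform_in_C_cone[OF c c' elim(2)] elim(1))
      fix x :: "real \<times> real" assume "\<delta> \<le> \<bar>B1 c x\<bar>"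
      thus "(L t = cone_scale (c + t *\<^sub>R c') \<and> \<delta> \<le> \<bar>fst x\<bar>) \<or> (L t = 1 / cone_scale (c + t *\<^sub>R c') \<and> \<delta> \<le> \<bar>snd x\<bar>)"
        using c by (auto simp: S_cusps_eq L_def B1_def)
    qed
  qed
  show "\<exists>K e. 0 < e \<and> (\<forall>\<^sub>F t in at_right 0. \<forall>x. \<delta> \<le> \<bar>B1 c x\<bar> \<longrightarrow>
      \<bar>p_component d (c + t *\<^sub>R c') \<alpha> \<beta> x - sgn_neg (fst x - snd x) * (fst x ^ \<alpha> * snd x ^ \<beta>)\<bar>
      * exp (- 2 * pi * Q1 x) \<le> K * exp (- e * (\<bar>fst x\<bar> + \<bar>snd x\<bar>)))"
    using \<delta> by (intro exI[of _ K] exI[of _ "pi * \<delta> / 16"] conjI eventually_mono[OF ev]) auto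
  assume x: "\<delta> \<le> \<bar>B1 c x\<bar>"
  have B_lim: "((\<lambda>t. B1 (c + t *\<^sub>R c') x) \<longlongrightarrow> B1 (c + 0 *\<^sub>R c') x) (at_right 0)"
    unfolding B1_def by (intro tendsto_intros)
  hence B_lim: "((\<lambda>t. B1 (c + t *\<^sub>R c') x) \<longlongrightarrow> B1 c x) (at_right 0)" by simp
  \<comment> \<open>\<open>B1 c x\<close> is nonzero, so its sign is stable under small
    deformations.\<close>
  have sgn_ev: "eventually (\<lambda>t. sgn_neg (B1 (c + t *\<^sub>R c') x) = sgn_neg (B1 c x)) (at_right 0)"
  proof (cases "B1 c x > 0")
    case True
    show ?thesis by (rule eventually_mono[OF order_tendstoD(1)[OF B_lim True]]) (simp add: sgn_neg_def True)
  next
    case False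
    hence "B1 c x < 0" using x \<delta> by (cases "B1 c x = 0") auto
    show ?thesis by (rule eventually_mono[OF order_tendstoD(2)[OF B_lim \<open>B1 c x < 0\<close>]]) (use False in \<open>simp add: sgn_neg_def\<close>)
  qed
  have "((\<lambda>t. p_component d (c + t *\<^sub>R c') \<alpha> \<beta> x - p_component d c \<alpha> \<beta> x) \<longlongrightarrow> 0) (at_right 0)"
  proof (rule Lim_null_comparison)
    show "((\<lambda>t. K * (1 / L t) * exp (2 * pi * Q1 x)) \<longlongrightarrow> 0) (at_right 0)"
      using tendsto_mult_right[OF tendsto_mult_left[OF L_lim, of K], of "exp (2 * pi * Q1 x)"] by simp
    show "\<forall>\<^sub>F t in at_right 0. norm (p_component d (c + t *\<^sub>R c') \<alpha> \<beta> x - p_component d c \<alpha> \<beta> x)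
        \<le> K * (1 / L t) * exp (2 * pi * Q1 x)"
      using ev sgn_ev
    proof eventually_elim
      case (elim t)
      let ?A = "\<bar>p_component d (c + t *\<^sub>R c') \<alpha> \<beta> x - p_component d c \<alpha> \<beta> x\<bar>"
      have "?A * exp (- 2 * pi * Q1 x) \<le> K * (1 / L t)"
        using conjunct1[OF elim(1)[rule_format, OF x]] unfolding elim(2) p_component_cusp[OF c] .
      hence "?A * exp (- 2 * pi * Q1 x) * exp (2 * pi * Q1 x) \<le> K * (1 / L t) * exp (2 * pi * Q1 x)"
        by (intro mult_right_mono) auto
      thus ?case by (simp add: mult.assoc flip: exp_add)
    qed
  qed
  thus "((\<lambda>t. p_component d (c + t *\<^sub>R c') \<alpha> \<beta> x) \<longlongrightarrow> p_component d c \<alpha> \<beta> x) (at_right 0)"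
    by (rule LIM_zero_cancel)
qed

section \<open>Domination on integer cosets\<close>

definition int_coset :: "real \<Rightarrow> real set" where
  "int_coset a = {x. x - a \<in> \<int>}"

text \<open>The elements of the coset nearest to 0 are \<open>frac a\<close> and
  \<open>frac a - 1\<close>.\<close>

lemma int_coset_bounded_away:
  assumes "a \<notin> \<int>"
  shows "\<exists>\<delta>>0. \<forall>x\<in>int_coset a. \<delta> \<le> \<bar>x\<bar>"
proof (intro exI[of _ "min (frac a) (1 - frac a)"] conjI ballI)
  show "0 < min (frac a) (1 - frac a)"
    using assms by (simp add: frac_lt_1 frac_gt_0_iff)
  fix x assume "x \<in> int_coset a"
  then obtain n where "x - a = of_int n" by (auto simp: int_coset_def elim: Ints_cases)
  hence x: "x = frac a + of_int (n + \<lfloor>a\<rfloor>)" by (simp add: frac_def)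
  show "min (frac a) (1 - frac a) \<le> \<bar>x\<bar>"
  proof (cases "n + \<lfloor>a\<rfloor> \<ge> 0")
    case True
    hence "real_of_int (n + \<lfloor>a\<rfloor>) \<ge> 0" by linarith
    thus ?thesis using x frac_ge_0[of a] by linarith
  next
    case False
    hence "real_of_int (n + \<lfloor>a\<rfloor>) \<le> - 1" by linarith
    thus ?thesis using x frac_lt_1[of a] by linarith
  qed
qed

text \<open>Unites a constant vector of the cone with a deformed cusp. The reference sign function
  does not depend on \<open>c\<close>, which makes it the same for both vectors of a pair.\<close>

lemma p_component_dominated:
  fixes c c' a :: "real \<times> real" and v :: real
  assumes c: "c \<in> C_bar" and a: "a \<in> R_set c" and c': "c \<in> S_cusps \<longrightarrow> c' \<in> C_cone" and v: "v > 0"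
  defines "ct \<equiv> \<lambda>t. if c \<in> S_cusps then c + t *\<^sub>R c' else c"
  shows "\<exists>K e. 0 < e \<and> (\<forall>\<^sub>F t in at_right 0. \<forall>x \<in> int_coset (fst a) \<times> int_coset (snd a).
      \<bar>p_component d (ct t) \<alpha> \<beta> (v *\<^sub>R x) - sgn_neg (fst (v *\<^sub>R x) - snd (v *\<^sub>R x)) *
          (fst (v *\<^sub>R x) ^ \<alpha> * snd (v *\<^sub>R x) ^ \<beta>)\<bar>
      * exp (- 2 * pi * Q1 (v *\<^sub>R x)) \<le> K * exp (- e * (\<bar>fst x\<bar> + \<bar>snd x\<bar>)))"
    and "x \<in> int_coset (fst a) \<times> int_coset (snd a) \<Longrightarrow>
      ((\<lambda>t. p_component d (ct t) \<alpha> \<beta> (v *\<^sub>R x)) \<longlongrightarrow> p_component d c \<alpha> \<beta> (v *\<^sub>R x)) (at_right 0)"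
proof -
  define H where "H c x = \<bar>p_component d c \<alpha> \<beta> x - sgn_neg (fst x - snd x) * (fst x ^ \<alpha> * snd x ^ \<beta>)\<bar>
      * exp (- 2 * pi * Q1 x)" for c x
  define \<Lambda> where "\<Lambda> = int_coset (fst a) \<times> int_coset (snd a)"
  \<comment> \<open>A bound in terms of v x becomes one in terms of x by absorbing v into the
    rate.\<close>
  have scale: "\<exists>K e. 0 < e \<and> (\<forall>\<^sub>F t in at_right 0. \<forall>x \<in> \<Lambda>. H (ct t) (v *\<^sub>R x) \<le> K * exp (- e * (\<bar>fst x\<bar> + \<bar>snd x\<bar>)))"
    if e: "0 < e" and ev: "\<forall>\<^sub>F t in at_right 0. \<forall>x \<in> \<Lambda>. H (ct t) (v *\<^sub>R x)
          \<le> K * exp (- e * (\<bar>fst (v *\<^sub>R x)\<bar> + \<bar>snd (v *\<^sub>R x)\<bar>))" for K e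
  proof (intro exI conjI)
    show "0 < e * v" using e v by simp
    show "\<forall>\<^sub>F t in at_right 0. \<forall>x \<in> \<Lambda>. H (ct t) (v *\<^sub>R x) \<le> K * exp (- (e * v) * (\<bar>fst x\<bar> + \<bar>snd x\<bar>))"
      using ev by eventually_elim (use v in \<open>simp add: abs_mult algebra_simps\<close>)
  qed
  have "(\<exists>K e. 0 < e \<and> (\<forall>\<^sub>F t in at_right 0. \<forall>x \<in> \<Lambda>. H (ct t) (v *\<^sub>R x) \<le> K * exp (- e * (\<bar>fst x\<bar> + \<bar>snd x\<bar>)))) \<and>
    (\<forall>x\<in>\<Lambda>. ((\<lambda>t. p_component d (ct t) \<alpha> \<beta> (v *\<^sub>R x)) \<longlongrightarrow> p_component d c \<alpha> \<beta> (v *\<^sub>R x)) (at_right 0))"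
  proof (cases "c \<in> S_cusps")
    case False
    hence cc: "c \<in> C_cone" and ct: "ct = (\<lambda>_. c)" using c by (auto simp: C_bar_def ct_def)
    obtain K e where "0 < e" "\<And>x. H c x \<le> K * exp (- e * (\<bar>fst x\<bar> + \<bar>snd x\<bar>))"
      using p_component_cone_bound[OF cc, of d \<alpha> \<beta>] unfolding H_def by blast
    thus ?thesis unfolding ct using scale[of e K, unfolded ct] by (auto simp del: fst_scaleR snd_scaleR)
  next
    case True
    have ct: "ct = (\<lambda>t. c + t *\<^sub>R c')" using True by (auto simp: ct_def)
    have "B1 c a \<notin> \<int>" using a not_C_cone_cusp[OF True] by (simp add: R_set_def)
    \<comment> \<open>Up to sign \<open>B1 c\<close> is a coordinate function, so its value at
      \<open>a\<close> being no integer bounds that coordinate away from 0 on the whole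
      coset.\<close>
    hence "\<exists>\<delta>>0. \<forall>x\<in>\<Lambda>. \<delta> \<le> \<bar>B1 c x\<bar>"
      using True int_coset_bounded_away[of "fst a"] int_coset_bounded_away[of "snd a"]
      by (auto simp: S_cusps_eq B1_def \<Lambda>_def)
    then obtain \<delta> where \<delta>: "\<delta> > 0" "\<And>x. x \<in> \<Lambda> \<Longrightarrow> \<delta> \<le> \<bar>B1 c x\<bar>" by blast
    have B: "v * \<delta> \<le> \<bar>B1 c (v *\<^sub>R x)\<bar>" if "x \<in> \<Lambda>" for x
    proof -
      have "B1 c (v *\<^sub>R x) = v * B1 c x" by (simp add: B1_def algebra_simps)
      thus ?thesis using \<delta>(2)[OF that] v by (simp add: abs_mult)
    qed
    have v\<delta>: "v * \<delta> > 0" using v \<delta> by simp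
    have cc': "c' \<in> C_cone" using c' True by simp
    obtain K e where Ke: "0 < e" "\<forall>\<^sub>F t in at_right 0. \<forall>x. v * \<delta> \<le> \<bar>B1 c x\<bar> \<longrightarrow>
      H (c + t *\<^sub>R c') x \<le> K * exp (- e * (\<bar>fst x\<bar> + \<bar>snd x\<bar>))"
      using p_component_deform_cusp(1)[OF True cc' v\<delta>, of d \<alpha> \<beta>] unfolding H_def by blast
    have "\<forall>\<^sub>F t in at_right 0. \<forall>x \<in> \<Lambda>. H (ct t) (v *\<^sub>R x)
          \<le> K * exp (- e * (\<bar>fst (v *\<^sub>R x)\<bar> + \<bar>snd (v *\<^sub>R x)\<bar>))"
      unfolding ct by (rule eventually_mono[OF Ke(2)]) (use B in blast)
    from scale[OF Ke(1) this] show ?thesis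
      unfolding ct using p_component_deform_cusp(2)[OF True cc' v\<delta> B] by blast
  qed
  thus "\<exists>K e. 0 < e \<and> (\<forall>\<^sub>F t in at_right 0. \<forall>x \<in> int_coset (fst a) \<times> int_coset (snd a).
      \<bar>p_component d (ct t) \<alpha> \<beta> (v *\<^sub>R x) - sgn_neg (fst (v *\<^sub>R x) - snd (v *\<^sub>R x)) *
          (fst (v *\<^sub>R x) ^ \<alpha> * snd (v *\<^sub>R x) ^ \<beta>)\<bar>
      * exp (- 2 * pi * Q1 (v *\<^sub>R x)) \<le> K * exp (- e * (\<bar>fst x\<bar> + \<bar>snd x\<bar>)))"
    "x \<in> int_coset (fst a) \<times> int_coset (snd a) \<Longrightarrow>
      ((\<lambda>t. p_component d (ct t) \<alpha> \<beta> (v *\<^sub>R x)) \<longlongrightarrow> p_component d c \<alpha> \<beta> (v *\<^sub>R x)) (at_right 0)"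
    unfolding H_def \<Lambda>_def by blast+
qed

section \<open>Summation over the lattice\<close>

text \<open>Dominated convergence for sums: by the Weierstrass M-test the finite partial sums
  converge uniformly in t, so the two limits may be exchanged.\<close>

lemma tendsto_infsum_dominated:
  fixes f :: "'b \<Rightarrow> 'a \<Rightarrow> 'c :: banach" and g :: "'a \<Rightarrow> real"
  assumes bound: "\<forall>\<^sub>F t in F. \<forall>x\<in>A. norm (f t x) \<le> g x" and g: "g summable_on A"
    and lim: "\<And>x. x \<in> A \<Longrightarrow> ((\<lambda>t. f t x) \<longlongrightarrow> l x) F" and F: "F \<noteq> bot"
  shows "((\<lambda>t. infsum (f t) A) \<longlongrightarrow> infsum l A) F"
proof (rule swap_uniform_limit'[where F = "finite_subsets_at_top A"])
  define S where "S = {t. \<forall>x\<in>A. norm (f t x) \<le> g x}"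
  show "uniform_limit S (\<lambda>X t. \<Sum>x\<in>X. f t x) (\<lambda>t. infsum (f t) A) (finite_subsets_at_top A)"
    by (rule Weierstrass_m_test_general[OF _ g]) (auto simp: S_def)
  show "\<forall>\<^sub>F t in F. t \<in> S" using bound by (simp add: S_def)
  show "\<forall>\<^sub>F X in finite_subsets_at_top A. ((\<lambda>t. \<Sum>x\<in>X. f t x) \<longlongrightarrow> (\<Sum>x\<in>X. l x)) F"
    by (rule eventually_finite_subsets_at_top_weakI) (auto intro!: tendsto_sum lim)
  have "norm (l x) \<le> g x" if "x \<in> A" for x
    by (rule tendsto_upperbound[OF tendsto_norm[OF lim[OF that]] _ F])
       (rule eventually_mono[OF bound], use that in auto)
  hence "l summable_on A"
    by (intro abs_summable_summable[OF Infinite_Sum.abs_summable_on_comparison_test'[OF g]])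
  thus "((\<lambda>X. \<Sum>x\<in>X. l x) \<longlongrightarrow> infsum l A) (finite_subsets_at_top A)"
    using has_sum_infsum by (simp add: has_sum_def)
qed simp

text \<open>Two geometric series cover the integers; the shift by \<open>a\<close> costs a factor of
  at most \<open>exp (e * \<bar>a\<bar>)\<close>.\<close>

lemma summable_on_exp_int_coset:
  assumes "e > 0"
  shows "(\<lambda>x. exp (- e * \<bar>x\<bar>)) summable_on int_coset a"
proof -
  have "summable (\<lambda>n. exp (- e) ^ n)" using assms by (intro summable_geometric) auto
  hence nat: "(\<lambda>n::nat. exp (- e) ^ n) summable_on UNIV"
    by (intro norm_summable_imp_summable_on) simp
  let ?h = "\<lambda>n::int. exp (- e * \<bar>of_int n\<bar>)"
  have e: "exp (- e) ^ n = exp (- (e * real n))" for n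
    by (simp add: exp_of_nat_mult[symmetric] mult.commute)
  have "?h summable_on (range int \<union> range (\<lambda>n. - int n))"
    by (intro summable_on_union; subst summable_on_reindex)
       (use nat in \<open>auto simp: o_def e inj_on_def\<close>)
  also have "range int \<union> range (\<lambda>n. - int n) = UNIV"
  proof -
    have "n \<in> range int \<union> range (\<lambda>n. - int n)" for n :: int
      by (cases n rule: int_cases2) auto
    thus ?thesis by auto
  qed
  finally have "(\<lambda>n. exp (e * \<bar>a\<bar>) * ?h n) summable_on UNIV" by (rule summable_on_cmult_right)
  hence "(\<lambda>n::int. exp (- e * \<bar>a + of_int n\<bar>)) summable_on UNIV"
  proof (rule summable_on_comparison_test)
    fix n :: int
    have "\<bar>of_int n\<bar> - \<bar>a\<bar> \<le> \<bar>a + of_int n\<bar>" by linarith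
    hence "e * (\<bar>of_int n\<bar> - \<bar>a\<bar>) \<le> e * \<bar>a + of_int n\<bar>" using assms by (intro mult_left_mono) auto
    thus "exp (- e * \<bar>a + of_int n\<bar>) \<le> exp (e * \<bar>a\<bar>) * ?h n"
      by (simp add: algebra_simps flip: exp_add)
  qed simp
  hence "(\<lambda>x. exp (- e * \<bar>x\<bar>)) summable_on range (\<lambda>n::int. a + of_int n)"
    by (subst summable_on_reindex) (auto simp: o_def inj_on_def)
  also have "range (\<lambda>n::int. a + of_int n) = int_coset a"
    by (auto simp: int_coset_def image_iff algebra_simps elim!: Ints_cases)
  finally show ?thesis .
qed

lemma countable_int_coset: "countable (int_coset a)"
proof -
  have "int_coset a \<subseteq> range (\<lambda>n::int. a + of_int n)"
    by (auto simp: int_coset_def image_iff algebra_simps elim!: Ints_cases)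
  thus ?thesis by (rule countable_subset) simp
qed

lemma summable_on_exp_int_coset_pair:
  assumes "e > 0"
  shows "(\<lambda>x. exp (- e * (\<bar>fst x\<bar> + \<bar>snd x\<bar>))) summable_on int_coset a \<times> int_coset b"
proof (rule summable_on_SigmaI)
  fix x assume "x \<in> int_coset a"
  have "((\<lambda>y. exp (- e * \<bar>x\<bar>) * exp (- e * \<bar>y\<bar>)) has_sum
      exp (- e * \<bar>x\<bar>) * (\<Sum>\<^sub>\<infinity>y\<in>int_coset b. exp (- e * \<bar>y\<bar>))) (int_coset b)"
    using summable_on_exp_int_coset[OF assms] by (intro has_sum_cmult_right has_sum_infsum)
  thus "((\<lambda>y. exp (- e * (\<bar>fst (x, y)\<bar> + \<bar>snd (x, y)\<bar>))) has_sum
      exp (- e * \<bar>x\<bar>) * (\<Sum>\<^sub>\<infinity>y\<in>int_coset b. exp (- e * \<bar>y\<bar>))) (int_coset b)"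
    by (simp add: algebra_simps flip: exp_add)
next
  show "(\<lambda>x. exp (- e * \<bar>x\<bar>) * (\<Sum>\<^sub>\<infinity>y\<in>int_coset b. exp (- e * \<bar>y\<bar>))) summable_on int_coset a"
    by (intro summable_on_cmult_left summable_on_exp_int_coset assms)
qed simp

text \<open>Gives access to \<open>abs_summable_on_prod_PiE\<close>, which is stated for the other
  notion of summability.\<close>

lemma summable_on_iff_abs_summable_on_count_space:
  "f summable_on A \<longleftrightarrow> Infinite_Set_Sum.abs_summable_on f A" for f :: "'a \<Rightarrow> real"
  by (rule trans[OF summable_on_iff_abs_summable_on_real abs_summable_equivalent])

text \<open>The shifted lattice is a product of coset pairs, so a product of summable functions of
  the separate components is summable.\<close>

lemma summable_on_shifted_lattice_prod:
  fixes a :: "'m::finite space" and g :: "'m \<Rightarrow> real \<times> real \<Rightarrow> real"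
  assumes "\<And>j. g j summable_on int_coset (fst (a $ j)) \<times> int_coset (snd (a $ j))"
  shows "(\<lambda>x. \<Prod>j\<in>UNIV. g j (x $ j)) summable_on shifted_lattice a"
proof -
  let ?B = "\<lambda>j. int_coset (fst (a $ j)) \<times> int_coset (snd (a $ j))"
  have "Infinite_Set_Sum.abs_summable_on (\<lambda>h. \<Prod>j\<in>UNIV. g j (h j)) (PiE UNIV ?B)"
    using assms unfolding summable_on_iff_abs_summable_on_count_space
    by (intro abs_summable_on_prod_PiE) (auto intro: countable_int_coset)
  hence "(\<lambda>h. \<Prod>j\<in>UNIV. g j (h j)) summable_on PiE UNIV ?B"
    by (simp only: summable_on_iff_abs_summable_on_count_space)
  also have "?this \<longleftrightarrow> ?thesis"
    by (rule summable_on_reindex_bij_witness[where i = "\<lambda>x j. x $ j" and j = "\<lambda>h. \<chi> j. h j"])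
       (auto simp: shifted_lattice_def int_coset_def PiE_UNIV_domain Pi_def mem_Times_iff)
  finally show ?thesis .
qed

text \<open>Both components are close to the same reference \<open>r\<close>, which cancels. This is
  essential: where x y < 0 the weight grows and \<open>r\<close> alone is not dominated.\<close>

lemma p_component_difference_dominated:
  fixes c0 c1 c0' c1' a :: "real \<times> real" and v :: real
  assumes c: "c0 \<in> C_bar" "c1 \<in> C_bar" and a: "a \<in> R_set c0 \<inter> R_set c1"
    and c': "c0 \<in> S_cusps \<longrightarrow> c0' \<in> C_cone" "c1 \<in> S_cusps \<longrightarrow> c1' \<in> C_cone" and v: "v > 0"
  shows "\<exists>g. g summable_on int_coset (fst a) \<times> int_coset (snd a) \<and>
    (\<forall>\<^sub>F t in at_right 0. \<forall>x \<in> int_coset (fst a) \<times> int_coset (snd a).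
      \<bar>p_component d (if c0 \<in> S_cusps then c0 + t *\<^sub>R c0' else c0) \<alpha> \<beta> (v *\<^sub>R x)
       - p_component d (if c1 \<in> S_cusps then c1 + t *\<^sub>R c1' else c1) \<alpha> \<beta> (v *\<^sub>R x)\<bar>
      * exp (- 2 * pi * Q1 (v *\<^sub>R x)) \<le> g x)"
proof -
  define \<Lambda> where "\<Lambda> = int_coset (fst a) \<times> int_coset (snd a)"
  define r where "r x = sgn_neg (fst (v *\<^sub>R x) - snd (v *\<^sub>R x)) * (fst (v *\<^sub>R x) ^ \<alpha> * snd (v *\<^sub>R x) ^ \<beta>)"
    for x :: "real \<times> real"
  define P where "P c c' t x = p_component d (if c \<in> S_cusps then c + t *\<^sub>R c' else c) \<alpha> \<beta> (v *\<^sub>R x)"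
    for c c' x :: "real \<times> real" and t :: real
  have "\<exists>g. g summable_on \<Lambda> \<and> (\<forall>\<^sub>F t in at_right 0. \<forall>x\<in>\<Lambda>. \<bar>P c c' t x - r x\<bar> * exp (- 2 * pi * Q1 (v *\<^sub>R x)) \<le> g x)"
    if cc: "c \<in> C_bar" "a \<in> R_set c" "c \<in> S_cusps \<longrightarrow> c' \<in> C_cone" for c c' :: "real \<times> real"
  proof -
    obtain K e where "0 < e" "\<forall>\<^sub>F t in at_right 0. \<forall>x\<in>\<Lambda>.
        \<bar>P c c' t x - r x\<bar> * exp (- 2 * pi * Q1 (v *\<^sub>R x)) \<le> K * exp (- e * (\<bar>fst x\<bar> + \<bar>snd x\<bar>))"
      using p_component_dominated(1)[OF cc v, of d \<alpha> \<beta>] unfolding P_def r_def \<Lambda>_def by blast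
    moreover have "(\<lambda>x. K * exp (- e * (\<bar>fst x\<bar> + \<bar>snd x\<bar>))) summable_on \<Lambda>"
      unfolding \<Lambda>_def by (intro summable_on_cmult_right summable_on_exp_int_coset_pair \<open>0 < e\<close>)
    ultimately show ?thesis by blast
  qed
  from this[of c0 c0'] this[of c1 c1'] assms obtain g0 g1 where
    g: "g0 summable_on \<Lambda>" "g1 summable_on \<Lambda>"
    and ev: "\<forall>\<^sub>F t in at_right 0. \<forall>x\<in>\<Lambda>. \<bar>P c0 c0' t x - r x\<bar> * exp (- 2 * pi * Q1 (v *\<^sub>R x)) \<le> g0 x"
      "\<forall>\<^sub>F t in at_right 0. \<forall>x\<in>\<Lambda>. \<bar>P c1 c1' t x - r x\<bar> * exp (- 2 * pi * Q1 (v *\<^sub>R x)) \<le> g1 x" by blast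
  have "\<forall>\<^sub>F t in at_right 0. \<forall>x\<in>\<Lambda>. \<bar>P c0 c0' t x - P c1 c1' t x\<bar> * exp (- 2 * pi * Q1 (v *\<^sub>R x)) \<le> g0 x + g1 x"
    using ev
  proof eventually_elim
    case (elim t)
    show ?case
    proof
      fix x assume x: "x \<in> \<Lambda>"
      have "\<bar>P c0 c0' t x - P c1 c1' t x\<bar> * exp (- 2 * pi * Q1 (v *\<^sub>R x)) \<le>
          (\<bar>P c0 c0' t x - r x\<bar> + \<bar>P c1 c1' t x - r x\<bar>) * exp (- 2 * pi * Q1 (v *\<^sub>R x))"
        by (intro mult_right_mono) auto
      also have "\<dots> \<le> g0 x + g1 x"
        unfolding distrib_right using elim x by (intro add_mono) blast+
      finally show "\<bar>P c0 c0' t x - P c1 c1' t x\<bar> * exp (- 2 * pi * Q1 (v *\<^sub>R x)) \<le> g0 x + g1 x" .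
    qed
  qed
  moreover have "(\<lambda>x. g0 x + g1 x) summable_on \<Lambda>" using g by (rule summable_on_add)
  ultimately show ?thesis unfolding P_def \<Lambda>_def by blast
qed

section \<open>Termwise estimate and limit of the theta series\<close>

lemma exp_Qm_eq_prod: "exp (- 2 * pi * Qm x) = (\<Prod>j\<in>UNIV. exp (- 2 * pi * Q1 (x $ j)))"
  by (simp add: Qm_def Q1_def sum_distrib_left flip: exp_sum sum_negf)

text \<open>The modulus involves the same argument scaled by \<open>sqrt (Im \<tau>)\<close> as
  \<open>p_fun\<close>, so weight and polynomial part can be paired component by component.\<close>

lemma norm_exp_Qm:
  assumes "Im \<tau> \<ge> 0"
  shows "norm (exp (2 * of_real pi * \<i> * of_real (Qm x) * \<tau>)) = exp (- 2 * pi * Qm (sqrt (Im \<tau>) *\<^sub>R x))"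
proof -
  have "Qm (sqrt (Im \<tau>) *\<^sub>R x) = Im \<tau> * Qm x"
  proof -
    have "sqrt (Im \<tau>) * sqrt (Im \<tau>) = Im \<tau>" using assms by simp
    hence "sqrt (Im \<tau>) * y * (sqrt (Im \<tau>) * z) = Im \<tau> * (y * z)" for y z :: real
      by (metis mult.assoc mult.left_commute)
    thus ?thesis unfolding Qm_def sum_distrib_left
      by (simp only: vector_scaleR_component fst_scaleR snd_scaleR real_scaleR_def)
  qed
  thus ?thesis by (simp add: norm_exp_eq_Re mult_ac)
qed

theorem theorem2p9:
  fixes f :: "'m::{finite,linorder} space \<Rightarrow> complex"
    and d :: nat
    and c0 c1 c0' c1' a b :: "'m space"
    and \<tau> :: complex
  assumes "spherical_poly d f"
    and "\<forall>j. c0 $ j \<in> C_bar" and "\<forall>j. c1 $ j \<in> C_bar"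
    and "\<forall>j. a $ j \<in> R_set (c0 $ j) \<inter> R_set (c1 $ j)"
    and "\<forall>j. c0 $ j \<in> S_cusps \<longrightarrow> c0' $ j \<in> C_cone"
    and "\<forall>j. c1 $ j \<in> S_cusps \<longrightarrow> c1' $ j \<in> C_cone"
    and "Im \<tau> > 0"
  shows "((\<lambda>t. theta d (deform c0 c0' t) (deform c1 c1' t) a b f \<tau>)
           \<longlongrightarrow> theta d c0 c1 a b f \<tau>) (at_right 0)"
proof -
  define A where "A = {p :: ('m \<Rightarrow> nat) \<times> ('m \<Rightarrow> nat). (\<Sum>j\<in>UNIV. fst p j + snd p j) = d}"
  define v where "v = sqrt (Im \<tau>)"
  have v: "v > 0" using assms(7) by (simp add: v_def)
  have A_eq: "A = {(\<alpha>, \<beta>). (\<Sum>j\<in>UNIV. \<alpha> j + \<beta> j) = d}" by (auto simp: A_def)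
  have fin: "finite A" unfolding A_eq by (rule finite_bi_indices)
  obtain coef where coef: "\<And>x. f x = (\<Sum>p\<in>A. coef p *
      of_real (\<Prod>j\<in>UNIV. fst (x $ j) ^ fst p j * snd (x $ j) ^ snd p j))"
    using assms(1) unfolding spherical_poly_def homogeneous_poly_def A_eq[symmetric]
    by (auto simp: case_prod_beta)
  define P where "P p j c x = p_component d c (fst p j) (snd p j) (v *\<^sub>R x)"
    for p :: "('m \<Rightarrow> nat) \<times> ('m \<Rightarrow> nat)" and j and c x :: "real \<times> real"
  have p_fun: "p_fun d c0 c1 f (v *\<^sub>R x) = (\<Sum>p\<in>A. coef p * of_real (\<Prod>j\<in>UNIV. P p j (c0 $ j) (x $ j) - P p j (c1 $ j) (x $ j)))"
    for c0 c1 x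
    using p_fun_eq_prod_components[of d c0 c1 coef "v *\<^sub>R x"]
    unfolding A_def[symmetric] coef[symmetric] by (simp add: P_def)
  let ?\<Lambda> = "\<lambda>j. int_coset (fst (a $ j)) \<times> int_coset (snd (a $ j))"
  \<comment> \<open>The index \<open>q\<close> pairs a monomial with a component, so a single use of
    choice supplies all majorants.\<close>
  have "\<forall>q. \<exists>g. g summable_on ?\<Lambda> (snd q) \<and> (\<forall>\<^sub>F t in at_right 0. \<forall>x\<in>?\<Lambda> (snd q).
      \<bar>P (fst q) (snd q) (deform c0 c0' t $ snd q) x - P (fst q) (snd q) (deform c1 c1' t $ snd q) x\<bar>
      * exp (- 2 * pi * Q1 (v *\<^sub>R x)) \<le> g x)"
    unfolding P_def deform_def vec_lambda_beta
    using assms v by (intro allI p_component_difference_dominated) auto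
  from choice[OF this] obtain g' where g': "\<And>q. g' q summable_on ?\<Lambda> (snd q)"
     "\<And>q. \<forall>\<^sub>F t in at_right 0. \<forall>x\<in>?\<Lambda> (snd q).
      \<bar>P (fst q) (snd q) (deform c0 c0' t $ snd q) x - P (fst q) (snd q) (deform c1 c1' t $ snd q) x\<bar>
      * exp (- 2 * pi * Q1 (v *\<^sub>R x)) \<le> g' q x"
    by blast
  define g where "g p j = g' (p, j)" for p j
  have g: "g p j summable_on ?\<Lambda> j"
    and ev: "\<forall>\<^sub>F t in at_right 0. \<forall>x\<in>?\<Lambda> j.
      \<bar>P p j (deform c0 c0' t $ j) x - P p j (deform c1 c1' t $ j) x\<bar> * exp (- 2 * pi * Q1 (v *\<^sub>R x)) \<le> g p j x"
    for p j using g'[of "(p, j)"] by (simp_all add: g_def)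
  define T where "T c0 c1 x = p_fun d c0 c1 f (v *\<^sub>R x) *
        exp (2 * of_real pi * \<i> * of_real (Qm x) * \<tau>) * exp (2 * of_real pi * \<i> * of_real (Bm x b))"
    for c0 c1 and x :: "'m space"
  have norm_T: "norm (T c0 c1 x) \<le> (\<Sum>p\<in>A. norm (coef p) *
      (\<Prod>j\<in>UNIV. \<bar>P p j (c0 $ j) (x $ j) - P p j (c1 $ j) (x $ j)\<bar> * exp (- 2 * pi * Q1 (v *\<^sub>R (x $ j)))))"
    for c0 c1 x
  proof -
    have 1: "norm (exp (2 * of_real pi * \<i> * of_real (Bm x b))) = 1"
      by (simp add: norm_exp_eq_Re)
    \<comment> \<open>The weight factors over the components and can thus be moved into the product
      of differences.\<close>
    have "norm (T c0 c1 x) = norm (p_fun d c0 c1 f (v *\<^sub>R x)) * (\<Prod>j\<in>UNIV. exp (- 2 * pi * Q1 (v *\<^sub>R (x $ j))))"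
      unfolding T_def norm_mult 1 norm_exp_Qm[OF less_imp_le[OF assms(7)]] v_def[symmetric] exp_Qm_eq_prod
      by (simp only: vector_scaleR_component mult_1_right)
    also have "\<dots> \<le> (\<Sum>p\<in>A. norm (coef p * of_real (\<Prod>j\<in>UNIV. P p j (c0 $ j) (x $ j) - P p j (c1 $ j) (x $ j))))
        * (\<Prod>j\<in>UNIV. exp (- 2 * pi * Q1 (v *\<^sub>R (x $ j))))"
      unfolding p_fun by (intro mult_right_mono norm_sum prod_nonneg) auto
    also have "\<dots> = (\<Sum>p\<in>A. norm (coef p) *
      (\<Prod>j\<in>UNIV. \<bar>P p j (c0 $ j) (x $ j) - P p j (c1 $ j) (x $ j)\<bar> * exp (- 2 * pi * Q1 (v *\<^sub>R (x $ j)))))"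
      by (simp only: norm_mult norm_of_real abs_prod prod.distrib sum_distrib_right mult.assoc)
    finally show ?thesis .
  qed
  have mem: "x $ j \<in> ?\<Lambda> j" if "x \<in> shifted_lattice a" for x j
    using that by (auto simp: shifted_lattice_def int_coset_def mem_Times_iff)
  have "((\<lambda>t. infsum (T (deform c0 c0' t) (deform c1 c1' t)) (shifted_lattice a))
      \<longlongrightarrow> infsum (T c0 c1) (shifted_lattice a)) (at_right 0)"
  proof (rule tendsto_infsum_dominated)
    show "(\<lambda>x. \<Sum>p\<in>A. norm (coef p) * (\<Prod>j\<in>UNIV. g p j (x $ j))) summable_on shifted_lattice a"
      unfolding summable_on_iff_abs_summable_on_count_space
      by (intro abs_summable_sum
            summable_on_iff_abs_summable_on_count_space[THEN iffD1]
            summable_on_cmult_right summable_on_shifted_lattice_prod g)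
    \<comment> \<open>Only finitely many monomials and components occur, so all bounds hold
      simultaneously for small t.\<close>
    have "\<forall>\<^sub>F t in at_right 0. \<forall>p\<in>A. \<forall>j. \<forall>x\<in>?\<Lambda> j.
        \<bar>P p j (deform c0 c0' t $ j) x - P p j (deform c1 c1' t $ j) x\<bar> * exp (- 2 * pi * Q1 (v *\<^sub>R x)) \<le> g p j x"
      by (intro eventually_ball_finite fin ballI eventually_all_finite ev)
    thus "\<forall>\<^sub>F t in at_right 0. \<forall>x\<in>shifted_lattice a. norm (T (deform c0 c0' t) (deform c1 c1' t) x)
        \<le> (\<Sum>p\<in>A. norm (coef p) * (\<Prod>j\<in>UNIV. g p j (x $ j)))"
    proof eventually_elim
      case (elim t)
      show ?case
        by (intro ballI order_trans[OF norm_T] sum_mono mult_left_mono prod_mono conjI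
              elim[rule_format] mem mult_nonneg_nonneg) simp_all
    qed
    fix x assume x: "x \<in> shifted_lattice a"
    have "((\<lambda>t. P p j (deform c0 c0' t $ j) (x $ j)) \<longlongrightarrow> P p j (c0 $ j) (x $ j)) (at_right 0)"
      "((\<lambda>t. P p j (deform c1 c1' t $ j) (x $ j)) \<longlongrightarrow> P p j (c1 $ j) (x $ j)) (at_right 0)" for p j
      unfolding P_def deform_def vec_lambda_beta
      using assms v mem[OF x] by (intro p_component_dominated(2)[where a = "a $ j"]; simp)+
    thus "((\<lambda>t. T (deform c0 c0' t) (deform c1 c1' t) x) \<longlongrightarrow> T c0 c1 x) (at_right 0)"
      unfolding T_def p_fun by (intro tendsto_intros)
  qed simp
  thus ?thesis
    unfolding theta_def T_def v_def[symmetric] by (intro tendsto_intros)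
qed

end
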